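(* Consider any one of Model 1, Model 1-w or Model 2 defined in the context, and let $\mathcal C_N$ denote its state space. For every $N\ge 1$, the continuous-time Markov chain on $\mathcal C_N$ defined by the model admits a unique invariant, reversible probability measure $\mu_N$, given by $$\forall h\in\mathcal C_N,\qquad \mu_N(h)=\frac1{Z_N}\exp\Big((2N)^{3/2}A_N(h)\Big),$$ where $Z_N$ is a normalising constant and $A_N(h)$ is the discrete weighted area $$A_N(h)=\frac1{4N}\sum_{k=1}^{2N-1}\log\Big(\frac{p_N(k_N)}{q_N(k_N)}\Big)h(k_N)\quad\text{in Model 1 and Model 1-w},$$ $$A_N(h)=\frac1{4N}\sum_{k=1}^{2N-1}\log\Big(\frac{p_N(k_N)}{q_N(k_N)}\Big)\big(h^{(1)}(k_N)-h^{(2)}(k_N)\big)\quad\text{in Model 2, } h=(h^{(1)},h^{(2)}).$$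
   Context: Let $N\ge1$ be an integer and $k_N:=k/(2N)$ for $0\le k\le 2N$. State spaces. $\mathcal C_N^{1}$ is the set of functions $h:[0,1]\to\mathbb R$ with $h(0)=h(1)=0$, $h(k_N)=h((k-1)_N)\pm\frac1{\sqrt{2N}}$ for all $1\le k\le 2N$, and $h$ affine on each $[(k-1)_N,k_N]$. $\mathcal C_N^{1w}$ is the set of $h\in\mathcal C_N^1$ with $h\ge0$ on $[0,1]$. $\mathcal C_N^2$ is the set of pairs $h=(h^{(1)},h^{(2)})$ with $h^{(1)},h^{(2)}\in\mathcal C_N^1$ and $h^{(1)}\ge h^{(2)}$ on $[0,1]$. These are the state spaces of Models 1, 1-w and 2 respectively. The discrete Laplacian is $\Delta h(k_N):=h((k+1)_N)-2h(k_N)+h((k-1)_N)$, $1\le k\le 2N-1$; it takes values in $\{-\frac2{\sqrt{2N}},0,\frac2{\sqrt{2N}}\}$. Rates. For each $1\le k\le 2N-1$, $p_N(k_N),q_N(k_N)$ are positive reals with $p_N(k_N)+q_N(k_N)=(2N)^2$. Dynamics (for each $1\le k\le 2N-1$, all driving Poisson processes independent). Model 1: $d\mathrm h_t(k_N)=\frac2{\sqrt{2N}}\big(dL_t(k_N)\mathbf 1_{\{\Delta \mathrm h_t(k_N)>0\}}-dR_t(k_N)\mathbf 1_{\{\Delta \mathrm h_t(k_N)<0\}}\big)$, where $L(k_N)$, $R(k_N)$ are Poisson processes of rates $p_N(k_N)$, $q_N(k_N)$. Model 1-w: the same, with the second indicator replaced by $\mathbf 1_{\{\Delta \mathrm h_t(k_N)<0;\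 \mathrm h_t(k_N)>1/\sqrt{2N}\}}$. Model 2: with Poisson processes $L^1(k_N),R^2(k_N)$ of rate $p_N(k_N)$ and $R^1(k_N),L^2(k_N)$ of rate $q_N(k_N)$, $d\mathrm h^{(1)}_t(k_N)=\frac2{\sqrt{2N}}\big(dL^1_t(k_N)\mathbf 1_{\{\Delta \mathrm h^{(1)}_t(k_N)>0\}}-dR^1_t(k_N)\mathbf 1_{\{\Delta \mathrm h^{(1)}_t(k_N)<0;\ \mathrm h^{(1)}_t(k_N)>\mathrm h^{(2)}_t(k_N)\}}\big)$, $d\mathrm h^{(2)}_t(k_N)=\frac2{\sqrt{2N}}\big(dL^2_t(k_N)\mathbf 1_{\{\Delta \mathrm h^{(2)}_t(k_N)>0;\ \mathrm h^{(1)}_t(k_N)>\mathrm h^{(2)}_t(k_N)\}}-dR^2_t(k_N)\mathbf 1_{\{\Delta \mathrm h^{(2)}_t(k_N)<0\}}\big)$. The indicators are evaluated just before the jump times (a jump occurs according to the configuration just before it). *)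

theory Defs
  imports "HOL-Probability.Probability"
begin

definition grid :: "nat \<Rightarrow> nat \<Rightarrow> real" where
  "grid N k = real k / (2 * real N)"

text \<open>A function on the unit interval is represented by a total function that is
  \<open>undefined\<close> outside of it, so that two states are equal iff they agree on \<open>[0,1]\<close>.\<close>

definition C1 :: "nat \<Rightarrow> (real \<Rightarrow> real) set" where
  "C1 N = {h \<in> extensional {0..1}.
     h 0 = 0 \<and> h 1 = 0 \<and>
     (\<forall>k\<in>{1..2*N}. h (grid N k) = h (grid N (k - 1)) + 1 / sqrt (2 * real N)
                 \<or> h (grid N k) = h (grid N (k - 1)) - 1 / sqrt (2 * real N)) \<and>
     (\<forall>k\<in>{1..2*N}. \<exists>a b. \<forall>x\<in>{grid N (k - 1)..grid N k}. h x = a * x + b)}"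

definition C1w :: "nat \<Rightarrow> (real \<Rightarrow> real) set" where
  "C1w N = {h \<in> C1 N. \<forall>x\<in>{0..1}. h x \<ge> 0}"

definition C2 :: "nat \<Rightarrow> ((real \<Rightarrow> real) \<times> (real \<Rightarrow> real)) set" where
  "C2 N = {h \<in> C1 N \<times> C1 N. \<forall>x\<in>{0..1}. fst h x \<ge> snd h x}"

definition laplacian :: "nat \<Rightarrow> (real \<Rightarrow> real) \<Rightarrow> nat \<Rightarrow> real" where
  "laplacian N h k = h (grid N (k + 1)) - 2 * h (grid N k) + h (grid N (k - 1))"

text \<open>Only nonnegative times are relevant. The subtraction on \<open>nat\<close> below is not
  truncating, since almost every path is nondecreasing.\<close>

definition poisson_process :: "'w measure \<Rightarrow> real \<Rightarrow> (real \<Rightarrow> 'w \<Rightarrow> nat) \<Rightarrow> bool" where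
  "poisson_process M a X \<longleftrightarrow>
     (\<forall>t\<ge>0. X t \<in> M \<rightarrow>\<^sub>M count_space UNIV) \<and>
     (AE \<omega> in M. X 0 \<omega> = 0 \<and> mono_on {0..} (\<lambda>t. X t \<omega>) \<and>
        (\<forall>t\<ge>0. continuous (at_right t) (\<lambda>s. X s \<omega>))) \<and>
     (\<forall>s t. 0 \<le> s \<and> s < t \<longrightarrow>
        distr M (count_space UNIV) (\<lambda>\<omega>. X t \<omega> - X s \<omega>) = measure_pmf (poisson_pmf (a * (t - s)))) \<and>
     (\<forall>\<tau>::nat \<Rightarrow> real. mono \<tau> \<and> 0 \<le> \<tau> 0 \<longrightarrow>
        prob_space.indep_vars M (\<lambda>_. count_space UNIV)
          (\<lambda>i \<omega>. X (\<tau> (Suc i)) \<omega> - X (\<tau> i) \<omega>) UNIV)"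

text \<open>Independence of the processes: each process \<open>X i\<close> is a random element of the
  space of all \<open>nat\<close>-valued functions on \<open>[0,\<infinity>)\<close> with the product \<open>\<sigma>\<close>-algebra.\<close>

definition independent_poisson ::
  "'w measure \<Rightarrow> 'i set \<Rightarrow> ('i \<Rightarrow> real) \<Rightarrow> ('i \<Rightarrow> real \<Rightarrow> 'w \<Rightarrow> nat) \<Rightarrow> bool" where
  "independent_poisson M I rate X \<longleftrightarrow>
     prob_space M \<and>
     (\<forall>i\<in>I. poisson_process M (rate i) (X i)) \<and>
     prob_space.indep_vars M (\<lambda>_. PiM {0..} (\<lambda>_. count_space UNIV))
       (\<lambda>i \<omega>. \<lambda>t\<in>{0..}. X i t \<omega>) I"

datatype clock = L nat | R nat

definition clocks :: "nat \<Rightarrow> clock set" where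
  "clocks N = L ` {1..2*N - 1} \<union> R ` {1..2*N - 1}"

fun rate :: "nat \<Rightarrow> (real \<Rightarrow> real) \<Rightarrow> (real \<Rightarrow> real) \<Rightarrow> clock \<Rightarrow> real" where
  "rate N p q (L k) = p (grid N k)"
| "rate N p q (R k) = q (grid N k)"

datatype clock2 = L1 nat | R1 nat | L2 nat | R2 nat

definition clocks2 :: "nat \<Rightarrow> clock2 set" where
  "clocks2 N = L1 ` {1..2*N - 1} \<union> R1 ` {1..2*N - 1} \<union> L2 ` {1..2*N - 1} \<union> R2 ` {1..2*N - 1}"

fun rate2 :: "nat \<Rightarrow> (real \<Rightarrow> real) \<Rightarrow> (real \<Rightarrow> real) \<Rightarrow> clock2 \<Rightarrow> real" where
  "rate2 N p q (L1 k) = p (grid N k)"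
| "rate2 N p q (R1 k) = q (grid N k)"
| "rate2 N p q (L2 k) = q (grid N k)"
| "rate2 N p q (R2 k) = p (grid N k)"

definition left_lim :: "(real \<Rightarrow> real) \<Rightarrow> real \<Rightarrow> real" where
  "left_lim f s = Lim (at_left s) f"

text \<open>The configuration just before time \<open>s\<close>, for a path \<open>x\<close> of height functions.\<close>

definition before :: "(real \<Rightarrow> real \<Rightarrow> real) \<Rightarrow> real \<Rightarrow> real \<Rightarrow> real" where
  "before x s = (\<lambda>u. left_lim (\<lambda>r. x r u) s)"

text \<open>The integral of \<open>1\<^sub>P\<close> over \<open>(0,t]\<close> against the counting path \<open>n\<close>: the sum over the jump
  times of \<open>n\<close> (finitely many for a Poisson path) of the jump sizes.\<close>

definition count_integral :: "(real \<Rightarrow> nat) \<Rightarrow> (real \<Rightarrow> bool) \<Rightarrow> real \<Rightarrow> real" where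
  "count_integral n P t =
     (\<Sum>s\<in>{s\<in>{0<..t}. left_lim (\<lambda>u. real (n u)) s \<noteq> real (n s)}.
        (real (n s) - left_lim (\<lambda>u. real (n u)) s) * of_bool (P s))"

text \<open>The systems of stochastic differential equations of the three models, in integrated form
  and for a single realisation \<open>n\<close> of the driving processes.\<close>

definition solves1 :: "nat \<Rightarrow> (clock \<Rightarrow> real \<Rightarrow> nat) \<Rightarrow> (real \<Rightarrow> real \<Rightarrow> real) \<Rightarrow> bool" where
  "solves1 N n x \<longleftrightarrow> (\<forall>t\<ge>0. \<forall>k\<in>{1..2*N - 1}.
     x t (grid N k) = x 0 (grid N k) + 2 / sqrt (2 * real N) *
       (count_integral (n (L k)) (\<lambda>s. laplacian N (before x s) k > 0) t
      - count_integral (n (R k)) (\<lambda>s. laplacian N (before x s) k < 0) t))"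

definition solves1w :: "nat \<Rightarrow> (clock \<Rightarrow> real \<Rightarrow> nat) \<Rightarrow> (real \<Rightarrow> real \<Rightarrow> real) \<Rightarrow> bool" where
  "solves1w N n x \<longleftrightarrow> (\<forall>t\<ge>0. \<forall>k\<in>{1..2*N - 1}.
     x t (grid N k) = x 0 (grid N k) + 2 / sqrt (2 * real N) *
       (count_integral (n (L k)) (\<lambda>s. laplacian N (before x s) k > 0) t
      - count_integral (n (R k)) (\<lambda>s. laplacian N (before x s) k < 0 \<and>
          before x s (grid N k) > 1 / sqrt (2 * real N)) t))"

definition solves2 ::
  "nat \<Rightarrow> (clock2 \<Rightarrow> real \<Rightarrow> nat) \<Rightarrow> (real \<Rightarrow> (real \<Rightarrow> real) \<times> (real \<Rightarrow> real)) \<Rightarrow> bool" where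
  "solves2 N n x \<longleftrightarrow>
    (let x1 = (\<lambda>t. fst (x t)); x2 = (\<lambda>t. snd (x t)) in
     \<forall>t\<ge>0. \<forall>k\<in>{1..2*N - 1}.
       x1 t (grid N k) = x1 0 (grid N k) + 2 / sqrt (2 * real N) *
         (count_integral (n (L1 k)) (\<lambda>s. laplacian N (before x1 s) k > 0) t
        - count_integral (n (R1 k)) (\<lambda>s. laplacian N (before x1 s) k < 0 \<and>
            before x1 s (grid N k) > before x2 s (grid N k)) t)
     \<and> x2 t (grid N k) = x2 0 (grid N k) + 2 / sqrt (2 * real N) *
         (count_integral (n (L2 k)) (\<lambda>s. laplacian N (before x2 s) k > 0 \<and>
            before x1 s (grid N k) > before x2 s (grid N k)) t
        - count_integral (n (R2 k)) (\<lambda>s. laplacian N (before x2 s) k < 0) t))"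

text \<open>\<open>H h\<close> is the chain on \<open>C\<close> started from the deterministic state \<open>h\<close> and driven by \<open>X\<close>.\<close>

definition driven_chain ::
  "'w measure \<Rightarrow> 's set \<Rightarrow> (('i \<Rightarrow> real \<Rightarrow> nat) \<Rightarrow> (real \<Rightarrow> 's) \<Rightarrow> bool) \<Rightarrow>
   ('i \<Rightarrow> real \<Rightarrow> 'w \<Rightarrow> nat) \<Rightarrow> ('s \<Rightarrow> real \<Rightarrow> 'w \<Rightarrow> 's) \<Rightarrow> bool" where
  "driven_chain M C slv X H \<longleftrightarrow> (\<forall>h\<in>C.
     (\<forall>t\<ge>0. H h t \<in> M \<rightarrow>\<^sub>M count_space C) \<and>
     (AE \<omega> in M. H h 0 \<omega> = h \<and> slv (\<lambda>i t. X i t \<omega>) (\<lambda>t. H h t \<omega>)))"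

definition transition :: "'w measure \<Rightarrow> ('s \<Rightarrow> real \<Rightarrow> 'w \<Rightarrow> 's) \<Rightarrow> real \<Rightarrow> 's \<Rightarrow> 's \<Rightarrow> real" where
  "transition M H t h h' = measure M {\<omega>\<in>space M. H h t \<omega> = h'}"

definition invariant_law :: "'s set \<Rightarrow> (real \<Rightarrow> 's \<Rightarrow> 's \<Rightarrow> real) \<Rightarrow> 's pmf \<Rightarrow> bool" where
  "invariant_law C P \<mu> \<longleftrightarrow> set_pmf \<mu> \<subseteq> C \<and>
     (\<forall>t\<ge>0. \<forall>h'\<in>C. measure_pmf.expectation \<mu> (\<lambda>h. P t h h') = pmf \<mu> h')"

definition reversible_law :: "'s set \<Rightarrow> (real \<Rightarrow> 's \<Rightarrow> 's \<Rightarrow> real) \<Rightarrow> 's pmf \<Rightarrow> bool" where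
  "reversible_law C P \<mu> \<longleftrightarrow> set_pmf \<mu> \<subseteq> C \<and>
     (\<forall>t\<ge>0. \<forall>h\<in>C. \<forall>h'\<in>C. pmf \<mu> h * P t h h' = pmf \<mu> h' * P t h' h)"

definition area1 :: "nat \<Rightarrow> (real \<Rightarrow> real) \<Rightarrow> (real \<Rightarrow> real) \<Rightarrow> (real \<Rightarrow> real) \<Rightarrow> real" where
  "area1 N p q h =
     1 / (4 * real N) * (\<Sum>k=1..2*N - 1. ln (p (grid N k) / q (grid N k)) * h (grid N k))"

definition area2 ::
  "nat \<Rightarrow> (real \<Rightarrow> real) \<Rightarrow> (real \<Rightarrow> real) \<Rightarrow> (real \<Rightarrow> real) \<times> (real \<Rightarrow> real) \<Rightarrow> real" where
  "area2 N p q h =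
     1 / (4 * real N) * (\<Sum>k=1..2*N - 1. ln (p (grid N k) / q (grid N k)) *
       (fst h (grid N k) - snd h (grid N k)))"

definition weight :: "nat \<Rightarrow> ('s \<Rightarrow> real) \<Rightarrow> 's \<Rightarrow> real" where
  "weight N A h = exp ((2 * real N) powr (3/2) * A h)"

definition gibbs_law :: "nat \<Rightarrow> 's set \<Rightarrow> ('s \<Rightarrow> real) \<Rightarrow> 's pmf \<Rightarrow> bool" where
  "gibbs_law N C A \<mu> \<longleftrightarrow> set_pmf \<mu> \<subseteq> C \<and>
     (\<forall>h\<in>C. pmf \<mu> h = 1 / (\<Sum>g\<in>C. weight N A g) * weight N A h)"

end

theory Submission
  imports Defs
begin

text \<open>
  In each model a ring of a clock \<open>i\<close>, at rate \<open>a i\<close>, applies a map \<open>flip i\<close> to the state: it flips a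
  corner of a path, or does nothing if that is forbidden. A flip that changes the state is undone by
  the opposite clock. Flipping a local minimum at \<open>k\<close> upwards changes \<open>(2N)\<^sup>3\<^sup>/\<^sup>2 A\<^sub>N\<close> by
  \<open>ln (p / q)\<close> (\<open>area1_shift\<close>); for the lower surface of the two-surface model the sign is opposite, but
  the two rates are swapped as well. So the Gibbs weight times the rate of a flip equals the Gibbs weight of
  the flipped state times the rate of the opposite flip: detailed balance.

  The transition probabilities are only known through pathwise equations, and detailed balance has
  to be carried over to them. Cut \<open>[0,t]\<close> into \<open>n\<close> slots of length \<open>\<delta> = t/n\<close>. If every slot has at
  most one ring, the state at time \<open>t\<close> is obtained by applying the flips of the clocks that rang
  (\<open>one_jump_update\<close>, \<open>AE_word_event\<close>), and the probability of a given sequence of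
  clocks is an explicit product. Hence the transition matrix lies between the \<open>n\<close>th power of the kernel
  \<open>e\<^sup>-\<^sup>\<Lambda>\<^sup>\<delta> (1 + \<Lambda>\<delta> + \<delta> G)\<close>, where \<open>G\<close> is the generator and \<open>\<Lambda>\<close> the total rate, and this power plus
  the probability \<open>O(1/n)\<close> of a slot with several rings (\<open>transition_lower\<close>, \<open>transition_upper\<close>).
  The kernel is symmetric for the Gibbs weight, so letting \<open>n\<close> tend to infinity gives reversibility,
  and with it invariance.

  For uniqueness, a single slot with \<open>t\<close> tending to zero shows that an invariant law \<open>\<nu>\<close> satisfies
  \<open>\<nu> G = 0\<close>. By symmetry of \<open>G\<close> the density of \<open>\<nu>\<close> with respect to the Gibbs law is harmonic. Flips
  lead from every state to an extremal one, because a path other than the tent has a local minimum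
  (\<open>exists_local_min\<close>) and a path other than its reflection a local maximum. So the maximum
  principle, applied to the density and to its negative, makes the density constant.
\<close>

section \<open>Counting paths and integrals against them\<close>

definition counting_path :: "(real \<Rightarrow> nat) \<Rightarrow> bool" where
  "counting_path n \<longleftrightarrow> mono_on {0..} n \<and> (\<forall>t\<ge>0. continuous (at_right t) n)"

definition jump_times :: "(real \<Rightarrow> nat) \<Rightarrow> real \<Rightarrow> real set" where
  "jump_times n t = {s\<in>{0<..t}. left_lim (\<lambda>u. real (n u)) s \<noteq> real (n s)}"

lemma count_integral_jump_times:
  "count_integral n P t =
     (\<Sum>s\<in>jump_times n t. (real (n s) - left_lim (\<lambda>u. real (n u)) s) * of_bool (P s))"
  by (simp add: count_integral_def jump_times_def)

lemma left_lim_eq: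
  assumes "s < \<sigma>" "\<And>r. s \<le> r \<Longrightarrow> r < \<sigma> \<Longrightarrow> f r = c"
  shows "left_lim f \<sigma> = c"
proof -
  have "eventually (\<lambda>r. f r = c) (at_left \<sigma>)"
    unfolding eventually_at_left_field using assms by (intro exI[of _ s]) auto
  then have "(f \<longlongrightarrow> c) (at_left \<sigma>)"
    by (rule tendsto_eventually)
  then show ?thesis
    unfolding left_lim_def by (intro tendsto_Lim) (auto simp: trivial_limit_at_left_real)
qed

lemma left_lim_real_eq:
  assumes "s < \<sigma>" "\<And>r. s \<le> r \<Longrightarrow> r < \<sigma> \<Longrightarrow> n r = (c :: nat)"
  shows "left_lim (\<lambda>u. real (n u)) \<sigma> = real c"
  by (rule left_lim_eq[OF assms(1)]) (use assms(2) in simp)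

lemma counting_pathD:
  assumes "counting_path n"
  shows "0 \<le> s \<Longrightarrow> s \<le> t \<Longrightarrow> n s \<le> n t"
    and "0 \<le> t \<Longrightarrow> \<exists>b>t. \<forall>r. t < r \<and> r < b \<longrightarrow> n r = n t"
proof -
  show "0 \<le> s \<Longrightarrow> s \<le> t \<Longrightarrow> n s \<le> n t"
    using assms by (auto simp: counting_path_def mono_on_def)
next
  assume "0 \<le> t"
  then have "(n \<longlongrightarrow> n t) (at_right t)"
    using assms by (auto simp: counting_path_def continuous_within)
  then have "eventually (\<lambda>r. n r = n t) (at_right t)"
    by (simp add: tendsto_discrete)
  then show "\<exists>b>t. \<forall>r. t < r \<and> r < b \<longrightarrow> n r = n t"
    by (simp add: eventually_at_right_field) blast
qed

text \<open>A nondecreasing path with values in the natural numbers takes finitely many values on a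
  bounded interval, so it is constant just before each time, and its left limit is its value there.\<close>

lemma left_lim_counting_path:
  assumes n: "counting_path n" and "0 < \<sigma>"
  obtains r where "0 \<le> r" "r < \<sigma>" "\<And>u. r \<le> u \<Longrightarrow> u < \<sigma> \<Longrightarrow> n u = n r"
    "left_lim (\<lambda>u. real (n u)) \<sigma> = real (n r)"
proof -
  have fin: "finite (n ` {0..<\<sigma>})"
    by (rule finite_subset[of _ "{..n \<sigma>}"]) (use counting_pathD(1)[OF n] in auto)
  have "n ` {0..<\<sigma>} \<noteq> {}"
    using \<open>0 < \<sigma>\<close> by auto
  then have "Max (n ` {0..<\<sigma>}) \<in> n ` {0..<\<sigma>}"
    using Max_in fin by blast
  then obtain r where r: "r \<in> {0..<\<sigma>}" "Max (n ` {0..<\<sigma>}) = n r"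
    by auto
  have const: "n u = n r" if "r \<le> u" "u < \<sigma>" for u
  proof (rule antisym)
    have "n u \<in> n ` {0..<\<sigma>}" using that r by auto
    then show "n u \<le> n r" using Max_ge[OF fin] r(2) by metis
    show "n r \<le> n u" using counting_pathD(1)[OF n] that r by auto
  qed
  have "left_lim (\<lambda>u. real (n u)) \<sigma> = real (n r)"
    using r by (intro left_lim_real_eq[OF _ const]) auto
  then show thesis
    using r(1) by (intro that[OF _ _ const]) simp_all
qed

text \<open>Between two jump times the path strictly increases, so it is injective on its jump times.
  Finiteness matters: the sum that defines the counting integral would be zero otherwise.\<close>

lemma finite_jump_times:
  assumes n: "counting_path n"
  shows "finite (jump_times n t)"
proof (rule finite_imageD)
  show "finite (n ` jump_times n t)"
    by (rule finite_subset[of _ "{..n t}"]) (use counting_pathD(1)[OF n] in \<open>auto simp: jump_times_def\<close>)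
  have less: "n s < n s'" if "s \<in> jump_times n t" "s' \<in> jump_times n t" "s < s'" for s s'
  proof -
    have "0 < s" "0 < s'" using that by (auto simp: jump_times_def)
    then obtain r where r: "0 \<le> r" "r < s'" "\<And>u. r \<le> u \<Longrightarrow> u < s' \<Longrightarrow> n u = n r"
      "left_lim (\<lambda>u. real (n u)) s' = real (n r)"
      using left_lim_counting_path[OF n, of s'] by metis
    have "n s \<le> n (max r s)" using counting_pathD(1)[OF n] \<open>0 < s\<close> by auto
    also have "\<dots> = n r" using r(3)[of "max r s"] r(2) that(3) by auto
    also have "n r < n s'"
      using r(1,2,4) that(2) counting_pathD(1)[OF n, of r s'] by (auto simp: jump_times_def)
    finally show ?thesis .
  qed
  show "inj_on n (jump_times n t)"
  proof (rule inj_onI)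
    fix s s' assume *: "s \<in> jump_times n t" "s' \<in> jump_times n t" "n s = n s'"
    show "s = s'"
      using less[OF *(1,2)] less[OF *(2,1)] *(3) by (cases s s' rule: linorder_cases) auto
  qed
qed

lemma jump_times_no_jump:
  assumes n: "counting_path n" and "0 \<le> s" "s \<le> t" and const: "n t = n s"
  shows "jump_times n t = jump_times n s"
proof -
  have eq: "n u = n s" if "s \<le> u" "u \<le> t" for u
    using counting_pathD(1)[OF n, of s u] counting_pathD(1)[OF n, of u t] that const \<open>0 \<le> s\<close> by auto
  have lim: "left_lim (\<lambda>u. real (n u)) u = real (n u)" if "s < u" "u \<le> t" for u
  proof (rule left_lim_real_eq[OF that(1)])
    show "n r = n u" if "s \<le> r" "r < u" for r
      using eq[of r] eq[of u] that \<open>s < u\<close> \<open>u \<le> t\<close> by simp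
  qed
  show ?thesis
  proof (rule set_eqI)
    fix u
    show "u \<in> jump_times n t \<longleftrightarrow> u \<in> jump_times n s"
      using lim[of u] assms(2,3) by (cases "u \<le> s") (auto simp: jump_times_def)
  qed
qed

lemma count_integral_no_jump:
  assumes "counting_path n" "0 \<le> s" "s \<le> t" "n t = n s"
  shows "count_integral n P t = count_integral n P s"
  using jump_times_no_jump[OF assms] by (simp add: count_integral_jump_times)

text \<open>The time \<open>\<sigma>\<close> does not depend on the integrand: it is the first time at which the path has
  its new value, which is attained by right continuity.\<close>

lemma count_integral_one_jump:
  assumes n: "counting_path n" and "0 \<le> s" "s \<le> t" and jump: "n t = n s + 1"
  obtains \<sigma> where "s < \<sigma>" "\<sigma> \<le> t" "\<And>r. s \<le> r \<Longrightarrow> r < \<sigma> \<Longrightarrow> n r = n s"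
    "\<And>P. count_integral n P t = count_integral n P s + of_bool (P \<sigma>)"
proof -
  define U where "U = {r. s \<le> r \<and> r \<le> t \<and> n r = n t}"
  define \<sigma> where "\<sigma> = Inf U"
  have U: "t \<in> U" "bdd_below U" using assms(3) by (auto simp: U_def)
  have \<sigma>: "s \<le> \<sigma>" "\<sigma> \<le> t"
    unfolding \<sigma>_def using U by (auto simp: U_def intro!: cInf_greatest cInf_lower)
  have before: "n r = n s" if "s \<le> r" "r < \<sigma>" for r
  proof -
    have "r \<notin> U" using cInf_lower[OF _ U(2)] that(2) unfolding \<sigma>_def by force
    then have "n r \<noteq> n t" using that \<sigma> by (auto simp: U_def)
    moreover have "n s \<le> n r" "n r \<le> n t"
      using counting_pathD(1)[OF n, of s r] counting_pathD(1)[OF n, of r t] that \<sigma> \<open>0 \<le> s\<close> by auto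
    ultimately show ?thesis using jump by simp
  qed
  obtain b where b: "b > \<sigma>" "\<forall>r. \<sigma> < r \<and> r < b \<longrightarrow> n r = n \<sigma>"
    using counting_pathD(2)[OF n, of \<sigma>] \<sigma> \<open>0 \<le> s\<close> by auto
  obtain r where r: "r \<in> U" "r < b"
    using cInf_lessD[of U b] U b(1) unfolding \<sigma>_def by auto
  have "\<sigma> \<le> r" using cInf_lower[OF r(1) U(2)] by (simp add: \<sigma>_def)
  then have n\<sigma>: "n \<sigma> = n t"
    using b(2) r by (cases "\<sigma> = r") (auto simp: U_def)
  then have "s < \<sigma>" using \<sigma> jump by (cases "s = \<sigma>") auto
  have lim: "left_lim (\<lambda>u. real (n u)) \<sigma> = real (n s)"
    by (rule left_lim_real_eq[OF \<open>s < \<sigma>\<close> before])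
  have lim': "left_lim (\<lambda>u. real (n u)) u = real (n u)" if "s < u" "u < \<sigma>" for u
  proof (rule left_lim_real_eq[OF that(1)])
    show "n r = n u" if "s \<le> r" "r < u" for r
      using before[of r] before[of u] that \<open>s < u\<close> \<open>u < \<sigma>\<close> by simp
  qed
  have "jump_times n t = jump_times n \<sigma>"
    by (rule jump_times_no_jump[OF n]) (use \<sigma> n\<sigma> \<open>0 \<le> s\<close> in auto)
  also have "\<dots> = insert \<sigma> (jump_times n s)"
  proof (rule set_eqI)
    fix u
    consider "u \<le> s" | "s < u" "u < \<sigma>" | "u = \<sigma>" | "\<sigma> < u" by linarith
    then show "u \<in> jump_times n \<sigma> \<longleftrightarrow> u \<in> insert \<sigma> (jump_times n s)"
      using \<open>s < \<sigma>\<close> \<open>0 \<le> s\<close> \<sigma> lim lim'[of u] jump n\<sigma> by cases (auto simp: jump_times_def)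
  qed
  finally have *: "jump_times n t = insert \<sigma> (jump_times n s)" .
  have notin: "\<sigma> \<notin> jump_times n s" using \<open>s < \<sigma>\<close> by (auto simp: jump_times_def)
  have "count_integral n P t = count_integral n P s + of_bool (P \<sigma>)" for P
    unfolding count_integral_jump_times *
    by (subst sum.insert[OF finite_jump_times[OF n] notin]) (simp add: lim n\<sigma> jump)
  then show thesis
    using that \<open>s < \<sigma>\<close> \<sigma> before by blast
qed

text \<open>The common content of the three systems of equations. The state is known from finitely many
  observables, observable \<open>k\<close> being raised by the clock \<open>up k\<close> and lowered by \<open>dn k\<close>. When at most one
  clock rings during an interval, and only once, the state is constant until that ring, so the
  configuration just before it is the one at the beginning of the interval. Simultaneous
  rings of different clocks never have to be discussed.\<close>

lemma one_jump_update:
  fixes x :: "real \<Rightarrow> 's" and obs :: "'k \<Rightarrow> 's \<Rightarrow> real" and n :: "'i \<Rightarrow> real \<Rightarrow> nat"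
  assumes eq: "\<And>t k. 0 \<le> t \<Longrightarrow> k \<in> K \<Longrightarrow> obs k (x t) = obs k (x 0) + c *
      (count_integral (n (up k)) (\<lambda>\<sigma>. A k (xm \<sigma>)) t
     - count_integral (n (dn k)) (\<lambda>\<sigma>. B k (xm \<sigma>)) t)"
    and xC: "\<And>t. 0 \<le> t \<Longrightarrow> x t \<in> C"
    and det: "\<And>h h'. h \<in> C \<Longrightarrow> h' \<in> C \<Longrightarrow> (\<And>k. k \<in> K \<Longrightarrow> obs k h = obs k h') \<Longrightarrow> h = h'"
    and xm: "\<And>s \<sigma> h. s < \<sigma> \<Longrightarrow> (\<And>r. s \<le> r \<Longrightarrow> r < \<sigma> \<Longrightarrow> x r = h) \<Longrightarrow> xm \<sigma> = h"
    and clocks: "\<And>k. k \<in> K \<Longrightarrow> up k \<in> I \<and> dn k \<in> I"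
    and n: "\<And>i. i \<in> I \<Longrightarrow> counting_path (n i)"
    and st: "0 \<le> s" "s \<le> t"
    and jump: "\<And>i. i \<in> I \<Longrightarrow> n i t = n i s + of_bool (z = Some i)"
    and k: "k \<in> K"
  shows "obs k (x t) = obs k (x s) + c *
      (of_bool (z = Some (up k) \<and> A k (x s)) - of_bool (z = Some (dn k) \<and> B k (x s)))"
proof -
  have const: "count_integral (n i) P r = count_integral (n i) P s"
    if "i \<in> I" "z \<noteq> Some i" "s \<le> r" "r \<le> t" for i P r
  proof (rule count_integral_no_jump[OF n[OF that(1)]])
    have "n i t = n i s" using jump[OF that(1)] that(2) by simp
    then show "n i r = n i s"
      using counting_pathD(1)[OF n[OF that(1)], of s r]
        counting_pathD(1)[OF n[OF that(1)], of r t] st that by simp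
  qed (use st that in auto)
  show ?thesis
  proof (cases "\<exists>i\<in>I. z = Some i")
    case False
    then show ?thesis
      using eq[OF _ k, of t] eq[OF _ k, of s] st clocks[OF k] const[of "up k" t] const[of "dn k" t]
      by auto
  next
    case True
    then obtain i where i: "i \<in> I" "z = Some i" by auto
    have jump': "n i t = n i s + 1"
      using jump[OF i(1)] i(2) by simp
    obtain \<sigma> where \<sigma>: "s < \<sigma>" "\<sigma> \<le> t" "\<And>r. s \<le> r \<Longrightarrow> r < \<sigma> \<Longrightarrow> n i r = n i s"
      "\<And>P. count_integral (n i) P t = count_integral (n i) P s + of_bool (P \<sigma>)"
      using count_integral_one_jump[OF n[OF i(1)] st jump'] by blast
    \<comment> \<open>Before the ring no observable changes, so neither does the state.\<close>
    have "x r = x s" if r: "s \<le> r" "r < \<sigma>" for r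
    proof (rule det)
      show "x r \<in> C" "x s \<in> C" using xC r st by auto
      have "count_integral (n j) P r = count_integral (n j) P s" if "j \<in> I" for j P
      proof (cases "j = i")
        case True
        then show ?thesis
          using count_integral_no_jump[OF n[OF i(1)], of s r] \<sigma>(3)[OF r] r st by auto
      next
        case False
        then show ?thesis
          using const[of j r P] that i r \<sigma>(1,2) by auto
      qed
      then show "obs k (x r) = obs k (x s)" if "k \<in> K" for k
        using eq[OF _ that, of r] eq[OF _ that, of s] r st clocks[OF that] by auto
    qed
    then have xm\<sigma>: "xm \<sigma> = x s" using xm \<sigma>(1) by blast
    have upd: "count_integral (n j) P t = count_integral (n j) P s + of_bool (z = Some j \<and> P \<sigma>)"
      if "j \<in> I" for j P
      using that const[of j t P] \<sigma>(4) i st by (cases "j = i") auto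
    show ?thesis
      using eq[OF _ k, of t] eq[OF _ k, of s] st clocks[OF k]
      by (simp add: upd xm\<sigma> algebra_simps)
  qed
qed

section \<open>Finite reversible flip dynamics\<close>

text \<open>When clock \<open>i\<close> rings, at rate \<open>a i\<close>, the state \<open>h\<close> becomes \<open>flip i h\<close>, which may be \<open>h\<close> itself:
  that encodes a ring suppressed by the indicators. The potential only serves irreducibility:
  since every other state can climb, all states lead to \<open>top_state\<close>.\<close>

locale flip_dynamics =
  fixes C :: "'s set" and I :: "'i set" and flip :: "'i \<Rightarrow> 's \<Rightarrow> 's" and undo :: "'i \<Rightarrow> 'i"
    and a :: "'i \<Rightarrow> real" and wt :: "'s \<Rightarrow> real" and top_state :: 's and potential :: "'s \<Rightarrow> real"
  assumes finite_C: "finite C" and finite_I: "finite I" and I_nonempty: "I \<noteq> {}"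
    and a_pos: "i \<in> I \<Longrightarrow> 0 < a i"
    and wt_pos: "h \<in> C \<Longrightarrow> 0 < wt h"
    and flip_closed: "i \<in> I \<Longrightarrow> h \<in> C \<Longrightarrow> flip i h \<in> C"
    and undo_in: "i \<in> I \<Longrightarrow> undo i \<in> I" and undo_undo: "i \<in> I \<Longrightarrow> undo (undo i) = i"
    and flip_undo: "i \<in> I \<Longrightarrow> h \<in> C \<Longrightarrow> flip i h \<noteq> h \<Longrightarrow> flip (undo i) (flip i h) = h"
    and detailed_balance:
      "i \<in> I \<Longrightarrow> h \<in> C \<Longrightarrow> flip i h \<noteq> h \<Longrightarrow> wt h * a i = wt (flip i h) * a (undo i)"
    and top_state_in: "top_state \<in> C"
    and climb: "h \<in> C \<Longrightarrow> h \<noteq> top_state \<Longrightarrow> \<exists>i\<in>I. potential h < potential (flip i h)"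
begin

definition generator :: "('s \<Rightarrow> real) \<Rightarrow> 's \<Rightarrow> real" where
  "generator f h = (\<Sum>i\<in>I. a i * (f (flip i h) - f h))"

definition inner :: "('s \<Rightarrow> real) \<Rightarrow> ('s \<Rightarrow> real) \<Rightarrow> real" where
  "inner f g = (\<Sum>h\<in>C. wt h * f h * g h)"

text \<open>The off-diagonal part of the generator as a bilinear form.\<close>

definition flux :: "('s \<Rightarrow> real) \<Rightarrow> ('s \<Rightarrow> real) \<Rightarrow> real" where
  "flux f g = (\<Sum>(i, h)\<in>{x\<in>I \<times> C. flip (fst x) (snd x) \<noteq> snd x}. wt h * a i * f h * g (flip i h))"

text \<open>Reversing an effective flip is an involution of the set of effective flips, under which detailed
  balance makes the summand exchange the roles of \<open>f\<close> and \<open>g\<close>.\<close>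

lemma flux_commute: "flux f g = flux g f"
proof -
  define r where "r = (\<lambda>(i, h). (undo i, flip i h))"
  define D where "D = {x\<in>I \<times> C. flip (fst x) (snd x) \<noteq> snd x}"
  have r: "r x \<in> D" "r (r x) = x" if "x \<in> D" for x
    using that undo_in flip_closed flip_undo[of "fst x" "snd x"] undo_undo
    by (auto simp: D_def r_def split_def)
  have val: "(case r x of (i, h) \<Rightarrow> wt h * a i * g h * f (flip i h)) =
      (case x of (i, h) \<Rightarrow> wt h * a i * f h * g (flip i h))" if "x \<in> D" for x
  proof -
    obtain i h where x: "x = (i, h)" by fastforce
    have ih: "i \<in> I" "h \<in> C" "flip i h \<noteq> h" using that by (auto simp: D_def x)
    have "wt (flip i h) * a (undo i) * g (flip i h) * f (flip (undo i) (flip i h))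
        = (wt h * a i) * g (flip i h) * f h"
      by (simp only: detailed_balance[OF ih] flip_undo[OF ih])
    then show ?thesis by (simp add: x r_def mult_ac)
  qed
  show ?thesis
    unfolding flux_def D_def[symmetric]
    by (rule sum.reindex_bij_witness[where i = r and j = r]) (use r val in auto)
qed

lemma inner_commute: "inner f g = inner g f"
  by (simp add: inner_def mult.commute mult.left_commute)

lemma inner_add: "inner f (\<lambda>h. g h + g' h) = inner f g + inner f g'"
  by (simp add: inner_def algebra_simps sum.distrib)

lemma inner_scale: "inner f (\<lambda>h. c * g h) = c * inner f g"
  by (simp add: inner_def sum_distrib_left mult_ac)

lemma inner_of_bool:
  assumes "h \<in> C"
  shows "inner (\<lambda>g. of_bool (g = h)) f = wt h * f h" "inner f (\<lambda>g. of_bool (g = h)) = wt h * f h"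
proof -
  have "(\<Sum>g\<in>C. wt g * of_bool (g = h) * f g) = (\<Sum>g\<in>C. if g = h then wt g * f g else 0)"
    by (intro sum.cong) auto
  then show "inner (\<lambda>g. of_bool (g = h)) f = wt h * f h"
    using assms by (simp add: inner_def sum.delta[OF finite_C])
  then show "inner f (\<lambda>g. of_bool (g = h)) = wt h * f h"
    by (simp add: inner_commute)
qed

lemma inner_generator: "inner f (generator g) = flux f g - flux (\<lambda>h. f h * g h) (\<lambda>_. 1)"
proof -
  have "inner f (generator g) = (\<Sum>(h, i)\<in>C \<times> I. wt h * a i * f h * (g (flip i h) - g h))"
    by (simp add: inner_def generator_def sum_distrib_left sum.cartesian_product[symmetric] mult_ac)
  also have "\<dots> = (\<Sum>(i, h)\<in>I \<times> C. wt h * a i * f h * (g (flip i h) - g h))"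
    by (rule sum.reindex_bij_witness[where i = prod.swap and j = prod.swap]) auto
  also have "\<dots> = (\<Sum>(i, h)\<in>{x\<in>I \<times> C. flip (fst x) (snd x) \<noteq> snd x}.
      wt h * a i * f h * (g (flip i h) - g h))"
    by (rule sum.mono_neutral_right) (use finite_C finite_I in auto)
  also have "\<dots> = flux f g - flux (\<lambda>h. f h * g h) (\<lambda>_. 1)"
    unfolding flux_def sum_subtractf[symmetric]
    by (intro sum.cong) (auto simp: algebra_simps)
  finally show ?thesis .
qed

lemma generator_symmetric: "inner f (generator g) = inner (generator f) g"
proof -
  have "inner f (generator g) = inner g (generator f)"
    unfolding inner_generator using flux_commute[of f g] by (simp add: mult.commute)
  then show ?thesis by (simp add: inner_commute)
qed

text \<open>Maximum principle. The maximisers of a harmonic function are stable under all flips. Among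
  them one of maximal potential cannot climb, hence is \<open>top_state\<close>.\<close>

lemma harmonic_le:
  assumes harm: "\<And>h. h \<in> C \<Longrightarrow> generator u h = 0" and "h \<in> C"
  shows "u h \<le> u top_state"
proof -
  define S where "S = {h\<in>C. \<forall>g\<in>C. u g \<le> u h}"
  have finS: "finite S" using finite_C by (simp add: S_def)
  have "\<exists>h\<in>C. u h = Max (u ` C)"
    using Max_in[of "u ` C"] finite_C top_state_in by fastforce
  then have "S \<noteq> {}"
    using finite_C by (auto simp: S_def)
  have closed: "flip i g \<in> S" if g: "g \<in> S" and i: "i \<in> I" for g i
  proof -
    have gC: "g \<in> C" and le: "\<And>g'. g' \<in> C \<Longrightarrow> u g' \<le> u g" using g by (auto simp: S_def)
    have nonneg: "0 \<le> a j * (u g - u (flip j g))" if "j \<in> I" for j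
      using a_pos[OF that] le[OF flip_closed[OF that gC]] by simp
    have "(\<Sum>j\<in>I. a j * (u g - u (flip j g))) = - generator u g"
      by (simp add: generator_def sum_negf[symmetric] algebra_simps)
    then have "(\<Sum>j\<in>I. a j * (u g - u (flip j g))) = 0"
      using harm[OF gC] by simp
    then have "a i * (u g - u (flip i g)) = 0"
      using sum_nonneg_eq_0_iff[of I "\<lambda>j. a j * (u g - u (flip j g))"] finite_I nonneg i by blast
    then have "u (flip i g) = u g" using a_pos[OF i] by simp
    then show ?thesis using flip_closed[OF i gC] le by (simp add: S_def)
  qed
  have "Max (potential ` S) \<in> potential ` S"
    using finS \<open>S \<noteq> {}\<close> by (intro Max_in) auto
  then obtain g where g: "g \<in> S" "potential g = Max (potential ` S)" by auto
  have "g = top_state"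
  proof (rule ccontr)
    assume "g \<noteq> top_state"
    then obtain i where i: "i \<in> I" "potential g < potential (flip i g)"
      using climb[of g] g(1) by (auto simp: S_def)
    have "potential (flip i g) \<le> Max (potential ` S)"
      using finS closed[OF g(1) i(1)] by simp
    with i g show False by simp
  qed
  then show ?thesis using g(1) \<open>h \<in> C\<close> by (simp add: S_def)
qed

lemma harmonic_constant:
  assumes harm: "\<And>h. h \<in> C \<Longrightarrow> generator u h = 0" and "h \<in> C"
  shows "u h = u top_state"
proof -
  have "generator (\<lambda>h. - u h) g = - generator u g" for g
    by (simp add: generator_def sum_negf[symmetric] algebra_simps)
  then have "- u h \<le> - u top_state"
    using harm \<open>h \<in> C\<close> by (intro harmonic_le) simp_all
  then show ?thesis using harmonic_le[OF assms] by simp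
qed

definition total_rate :: real where
  "total_rate = (\<Sum>i\<in>I. a i)"

text \<open>A word records, slot after slot, which clock rang, or that none did. The two functions
  \<open>symbol_prob \<delta>\<close> and \<open>word_prob \<delta>\<close> give the probabilities of these observations for slots of length
  \<open>\<delta>\<close>. A slot with two or more rings has no symbol, so the symbol probabilities add up to \<open>single_prob \<delta>\<close>
  and \<open>kernel \<delta>\<close> is only sub-Markovian. Symmetry and the closed form below are exact because of this.\<close>

definition symbols :: "'i option set" where
  "symbols = insert None (Some ` I)"

definition act :: "'i option \<Rightarrow> 's \<Rightarrow> 's" where
  "act z h = (case z of None \<Rightarrow> h | Some i \<Rightarrow> flip i h)"

definition symbol_prob :: "real \<Rightarrow> 'i option \<Rightarrow> real" where
  "symbol_prob \<delta> z = exp (- total_rate * \<delta>) * (case z of None \<Rightarrow> 1 | Some i \<Rightarrow> a i * \<delta>)"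

definition kernel :: "real \<Rightarrow> ('s \<Rightarrow> real) \<Rightarrow> 's \<Rightarrow> real" where
  "kernel \<delta> f h = (\<Sum>z\<in>symbols. symbol_prob \<delta> z * f (act z h))"

definition words :: "nat \<Rightarrow> 'i option list set" where
  "words n = {w. set w \<subseteq> symbols \<and> length w = n}"

definition word_prob :: "real \<Rightarrow> 'i option list \<Rightarrow> real" where
  "word_prob \<delta> w = prod_list (map (symbol_prob \<delta>) w)"

definition single_prob :: "real \<Rightarrow> real" where
  "single_prob \<delta> = exp (- total_rate * \<delta>) * (1 + total_rate * \<delta>)"

lemma total_rate_nonneg: "0 \<le> total_rate"
  unfolding total_rate_def using a_pos by (intro sum_nonneg) (simp add: less_imp_le)

lemma act_closed: "z \<in> symbols \<Longrightarrow> h \<in> C \<Longrightarrow> act z h \<in> C"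
  by (auto simp: symbols_def act_def flip_closed)

lemma fold_act_closed: "set w \<subseteq> symbols \<Longrightarrow> h \<in> C \<Longrightarrow> fold act w h \<in> C"
  by (induction w arbitrary: h) (auto simp: act_closed)

lemma sum_symbols: "sum f symbols = f None + (\<Sum>i\<in>I. f (Some i))"
  using finite_I by (simp add: symbols_def sum.reindex inj_on_def)

text \<open>The link between the observed slots and the generator, without error term.\<close>

lemma kernel_eq: "kernel \<delta> f h = single_prob \<delta> * f h + exp (- total_rate * \<delta>) * \<delta> * generator f h"
  by (simp add: kernel_def sum_symbols symbol_prob_def act_def single_prob_def generator_def total_rate_def
      algebra_simps sum_distrib_left sum_subtractf)

lemma finite_words: "finite (words n)"
  unfolding words_def by (rule finite_lists_length_eq) (simp add: symbols_def finite_I)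

lemma words_0: "words 0 = {[]}"
  by (auto simp: words_def)

lemma sum_words_Suc: "(\<Sum>w\<in>words (Suc n). f w) = (\<Sum>z\<in>symbols. \<Sum>w\<in>words n. f (z # w))"
proof -
  have "words (Suc n) = (\<lambda>(z, w). z # w) ` (symbols \<times> words n)"
    by (auto simp: words_def length_Suc_conv image_iff)
  moreover have "inj_on (\<lambda>(z, w). z # w) (symbols \<times> words n)"
    by (auto simp: inj_on_def)
  ultimately show ?thesis
    by (simp add: sum.reindex sum.cartesian_product split_def)
qed

lemma kernel_pow_words: "(kernel \<delta> ^^ n) f h = (\<Sum>w\<in>words n. word_prob \<delta> w * f (fold act w h))"
proof (induction n arbitrary: h)
  case 0
  then show ?case by (simp add: words_0 word_prob_def)
next
  case (Suc n)
  have "(kernel \<delta> ^^ Suc n) f h = (\<Sum>z\<in>symbols. symbol_prob \<delta> z * (kernel \<delta> ^^ n) f (act z h))"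
    by (simp add: kernel_def)
  then show ?case
    by (simp add: sum_words_Suc Suc.IH sum_distrib_left word_prob_def mult_ac)
qed

lemma kernel_pow_one: "(kernel \<delta> ^^ n) (\<lambda>_. 1) h = single_prob \<delta> ^ n"
proof (induction n arbitrary: h)
  case (Suc n)
  have "(kernel \<delta> ^^ n) (\<lambda>_. 1) = (\<lambda>_. single_prob \<delta> ^ n)"
    using Suc.IH by blast
  then have "(kernel \<delta> ^^ Suc n) (\<lambda>_. 1) h = kernel \<delta> (\<lambda>_. single_prob \<delta> ^ n) h"
    by simp
  then show ?case
    unfolding kernel_eq by (simp add: generator_def)
qed simp

lemma kernel_symmetric: "inner f (kernel \<delta> g) = inner (kernel \<delta> f) g"
proof -
  have eq: "inner f (kernel \<delta> g) = single_prob \<delta> * inner f g + exp (- total_rate * \<delta>) * \<delta> * inner f (generator g)"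
    for f g
    by (simp add: kernel_eq[abs_def] inner_add inner_scale)
  show ?thesis
    using eq[of f g] eq[of g f] generator_symmetric[of f g] inner_commute by metis
qed

lemma kernel_pow_symmetric: "inner f ((kernel \<delta> ^^ n) g) = inner ((kernel \<delta> ^^ n) f) g"
proof (induction n arbitrary: f g)
  case (Suc n)
  have "inner f ((kernel \<delta> ^^ Suc n) g) = inner ((kernel \<delta> ^^ n) (kernel \<delta> f)) g"
    using Suc.IH by (simp add: kernel_symmetric)
  then show ?case by (simp add: funpow_swap1)
qed simp

lemma sum_kernel_pow:
  assumes "h \<in> C"
  shows "(\<Sum>h'\<in>C. (kernel \<delta> ^^ n) (\<lambda>g. of_bool (g = h')) h) = single_prob \<delta> ^ n"
proof -
  have "(\<Sum>h'\<in>C. (kernel \<delta> ^^ n) (\<lambda>g. of_bool (g = h')) h)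
      = (\<Sum>w\<in>words n. \<Sum>h'\<in>C. word_prob \<delta> w * of_bool (fold act w h = h'))"
    unfolding kernel_pow_words by (rule sum.swap)
  also have "\<dots> = (\<Sum>w\<in>words n. word_prob \<delta> w * (\<Sum>h'\<in>C. of_bool (fold act w h = h')))"
    by (simp only: sum_distrib_left)
  also have "\<dots> = (\<Sum>w\<in>words n. word_prob \<delta> w * 1)"
  proof (rule sum.cong)
    fix w assume "w \<in> words n"
    then have "fold act w h \<in> C" using fold_act_closed assms by (simp add: words_def)
    then have "(\<Sum>h'\<in>C. of_bool (fold act w h = h')) = (1 :: real)"
      using finite_C by (simp add: of_bool_def)
    then show "word_prob \<delta> w * (\<Sum>h'\<in>C. of_bool (fold act w h = h')) = word_prob \<delta> w * 1"
      by simp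
  qed simp
  also have "\<dots> = single_prob \<delta> ^ n"
    using kernel_pow_words[of n \<delta> "\<lambda>_. 1" h] kernel_pow_one by simp
  finally show ?thesis .
qed

lemma single_prob_bounds:
  assumes "0 \<le> \<delta>"
  shows "0 \<le> single_prob \<delta>" "single_prob \<delta> \<le> 1" "1 - (total_rate * \<delta>)\<^sup>2 \<le> single_prob \<delta>"
proof -
  define y where "y = total_rate * \<delta>"
  have y: "0 \<le> y" using total_rate_nonneg assms by (simp add: y_def)
  have eq: "single_prob \<delta> = exp (- y) * (1 + y)" by (simp add: single_prob_def y_def)
  show "0 \<le> single_prob \<delta>" using y by (simp add: eq)
  have "exp (- y) * (1 + y) \<le> exp (- y) * exp y"
    using exp_ge_add_one_self[of y] by (intro mult_left_mono) auto
  then show "single_prob \<delta> \<le> 1" by (simp add: eq exp_minus)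
  have "(1 + - y) * (1 + y) \<le> exp (- y) * (1 + y)"
    using exp_ge_add_one_self[of "- y"] y by (intro mult_right_mono) auto
  then have "1 - y\<^sup>2 \<le> exp (- y) * (1 + y)"
    by (simp add: power2_eq_square algebra_simps)
  then show "1 - (total_rate * \<delta>)\<^sup>2 \<le> single_prob \<delta>"
    unfolding eq y_def[symmetric] .
qed

text \<open>The probability that some slot is bad when \<open>[0,t]\<close> is cut into \<open>n\<close> slots vanishes as \<open>n\<close> grows.\<close>

lemma single_prob_pow_bound:
  assumes "0 \<le> t" "1 \<le> n"
  shows "1 - single_prob (t / real n) ^ n \<le> (total_rate * t)\<^sup>2 / real n"
proof -
  let ?s = "single_prob (t / real n)"
  have b: "0 \<le> ?s" "1 - (total_rate * (t / real n))\<^sup>2 \<le> ?s"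
    using single_prob_bounds[of "t / real n"] assms by auto
  have "1 + real n * (?s - 1) \<le> (1 + (?s - 1)) ^ n"
    using b by (intro Bernoulli_inequality) simp
  moreover have "real n * (1 - ?s) \<le> real n * (total_rate * (t / real n))\<^sup>2"
    using b by (intro mult_left_mono) auto
  moreover have "real n * (total_rate * (t / real n))\<^sup>2 = (total_rate * t)\<^sup>2 / real n"
    using assms by (simp add: power2_eq_square field_simps)
  ultimately show ?thesis by (simp add: algebra_simps)
qed

lemma prod_poisson_symbol:
  assumes "z \<in> symbols" "0 < \<delta>"
  shows "(\<Prod>i\<in>I. pmf (poisson_pmf (a i * \<delta>)) (of_bool (z = Some i))) = symbol_prob \<delta> z"
proof -
  have "(\<Prod>i\<in>I. pmf (poisson_pmf (a i * \<delta>)) (of_bool (z = Some i)))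
      = (\<Prod>i\<in>I. (if z = Some i then a i * \<delta> else 1) * exp (- (a i * \<delta>)))"
    using a_pos assms(2) by (intro prod.cong) auto
  also have "\<dots> = (\<Prod>i\<in>I. if z = Some i then a i * \<delta> else 1) * exp (- total_rate * \<delta>)"
    using finite_I
    by (simp add: prod.distrib exp_sum[symmetric] total_rate_def sum_distrib_right sum_negf)
  also have "(\<Prod>i\<in>I. if z = Some i then a i * \<delta> else 1) = (case z of None \<Rightarrow> 1 | Some i \<Rightarrow> a i * \<delta>)"
    using assms(1) finite_I by (auto simp: symbols_def)
  finally show ?thesis by (simp add: symbol_prob_def mult.commute)
qed

end

lemma nonpos_if_le_over_n:
  fixes d c :: real
  assumes "\<And>n. 1 \<le> n \<Longrightarrow> d \<le> c / real n"
  shows "d \<le> 0"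
proof (rule LIMSEQ_le_const[OF lim_const_over_n[of c]])
  show "\<exists>N. \<forall>n\<ge>N. d \<le> c / real n"
    using assms by blast
qed

section \<open>Chains driven by independent Poisson clocks\<close>

text \<open>The assumption \<open>step\<close> abstracts from the driving equations: it only speaks of time intervals that
  contain at most one ring, on which a solution follows the flips.\<close>

locale driven_flips = flip_dynamics +
  fixes M :: "'w measure" and X :: "'b \<Rightarrow> real \<Rightarrow> 'w \<Rightarrow> nat" and H :: "'a \<Rightarrow> real \<Rightarrow> 'w \<Rightarrow> 'a"
    and slv :: "('b \<Rightarrow> real \<Rightarrow> nat) \<Rightarrow> (real \<Rightarrow> 'a) \<Rightarrow> bool"
  assumes driving: "independent_poisson M I a X" and chain: "driven_chain M C slv X H"
    and step: "\<lbrakk>slv n x; \<And>i. i \<in> I \<Longrightarrow> counting_path (n i); \<And>t. 0 \<le> t \<Longrightarrow> x t \<in> C; 0 \<le> s; s \<le> t;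
      z \<in> symbols; \<And>i. i \<in> I \<Longrightarrow> n i t = n i s + of_bool (z = Some i)\<rbrakk> \<Longrightarrow> x t = act z (x s)"
begin

sublocale prob_space M
  using driving by (simp add: independent_poisson_def)

definition word_event :: "real \<Rightarrow> 'b option list \<Rightarrow> 'w set" where
  "word_event \<delta> w = {\<omega>\<in>space M. \<forall>i\<in>I. \<forall>j<length w.
     X i (real (Suc j) * \<delta>) \<omega> - X i (real j * \<delta>) \<omega> = of_bool (w ! j = Some i)}"

lemma poisson: "i \<in> I \<Longrightarrow> poisson_process M (a i) (X i)"
  using driving by (simp add: independent_poisson_def)

lemma X_measurable [measurable]: "i \<in> I \<Longrightarrow> 0 \<le> t \<Longrightarrow> X i t \<in> M \<rightarrow>\<^sub>M count_space UNIV"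
  using poisson[of i] by (simp add: poisson_process_def)

lemma H_measurable: "h \<in> C \<Longrightarrow> 0 \<le> t \<Longrightarrow> H h t \<in> M \<rightarrow>\<^sub>M count_space C"
  using chain by (simp add: driven_chain_def)

lemma H_in: "h \<in> C \<Longrightarrow> 0 \<le> t \<Longrightarrow> \<omega> \<in> space M \<Longrightarrow> H h t \<omega> \<in> C"
  using measurable_space[OF H_measurable] by simp

lemma H_event: "h \<in> C \<Longrightarrow> 0 \<le> t \<Longrightarrow> {\<omega>\<in>space M. H h t \<omega> = h'} \<in> events"
proof -
  assume "h \<in> C" "0 \<le> t"
  then have "H h t -` ({h'} \<inter> C) \<inter> space M \<in> events"
    by (intro measurable_sets[OF H_measurable]) auto
  moreover have "H h t -` ({h'} \<inter> C) \<inter> space M = {\<omega>\<in>space M. H h t \<omega> = h'}"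
    using H_in[OF \<open>h \<in> C\<close> \<open>0 \<le> t\<close>] by auto
  ultimately show ?thesis by simp
qed

lemma word_event_measurable: "0 \<le> \<delta> \<Longrightarrow> word_event \<delta> w \<in> events"
proof -
  assume \<delta>: "0 \<le> \<delta>"
  have "{\<omega>\<in>space M. X i (real (Suc j) * \<delta>) \<omega> - X i (real j * \<delta>) \<omega> = of_bool (w ! j = Some i)} \<in> events"
    if "i \<in> I" for i j
  proof -
    have [measurable]: "X i (real (Suc j) * \<delta>) \<in> M \<rightarrow>\<^sub>M count_space UNIV"
      "X i (real j * \<delta>) \<in> M \<rightarrow>\<^sub>M count_space UNIV"
      using X_measurable[OF that] \<delta> by auto
    show ?thesis by measurable
  qed
  then show ?thesis
    unfolding word_event_def
    by (intro sets.sets_Collect_finite_All' sets.sets_Collect_finite_All finite_I I_nonempty) auto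
qed

lemma prob_increment:
  assumes "i \<in> I" "0 < \<delta>"
  shows "prob {\<omega>\<in>space M. X i (real (Suc j) * \<delta>) \<omega> - X i (real j * \<delta>) \<omega> = d} = pmf (poisson_pmf (a i * \<delta>)) d"
proof -
  let ?s = "real j * \<delta>" and ?t = "real (Suc j) * \<delta>"
  have st: "0 \<le> ?s" "?s < ?t" using assms(2) by auto
  have [measurable]: "X i ?s \<in> M \<rightarrow>\<^sub>M count_space UNIV" "X i ?t \<in> M \<rightarrow>\<^sub>M count_space UNIV"
    using X_measurable[OF assms(1)] st by auto
  have mes: "(\<lambda>\<omega>. X i ?t \<omega> - X i ?s \<omega>) \<in> M \<rightarrow>\<^sub>M count_space UNIV"
    by measurable
  have "a i * (?t - ?s) = a i * \<delta>" by (simp add: algebra_simps)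
  then have distr: "distr M (count_space UNIV) (\<lambda>\<omega>. X i ?t \<omega> - X i ?s \<omega>) = measure_pmf (poisson_pmf (a i * \<delta>))"
    using poisson[OF assms(1)] st unfolding poisson_process_def by metis
  have "prob {\<omega>\<in>space M. X i ?t \<omega> - X i ?s \<omega> = d}
      = measure (distr M (count_space UNIV) (\<lambda>\<omega>. X i ?t \<omega> - X i ?s \<omega>)) {d}"
    by (subst measure_distr[OF mes]) (auto intro!: arg_cong[where f = prob])
  also have "\<dots> = pmf (poisson_pmf (a i * \<delta>)) d"
    unfolding distr by (simp add: measure_pmf_single)
  finally show ?thesis .
qed

lemma prob_increments:
  assumes "i \<in> I" "0 < \<delta>" "0 < m"
  shows "prob {\<omega>\<in>space M. \<forall>j<m. X i (real (Suc j) * \<delta>) \<omega> - X i (real j * \<delta>) \<omega> = d j}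
    = (\<Prod>j<m. pmf (poisson_pmf (a i * \<delta>)) (d j))"
proof -
  define D where "D = (\<lambda>j \<omega>. X i (real (Suc j) * \<delta>) \<omega> - X i (real j * \<delta>) \<omega>)"
  have "mono (\<lambda>j. real j * \<delta>) \<and> 0 \<le> real 0 * \<delta>"
    using assms(2) by (auto simp: mono_def mult_right_mono)
  then have "indep_vars (\<lambda>_. count_space UNIV) D UNIV"
    using poisson[OF assms(1)] unfolding poisson_process_def D_def by blast
  then have ind: "indep_sets (\<lambda>j. {D j -` A \<inter> space M |A. A \<in> sets (count_space UNIV)}) UNIV"
    by (simp add: indep_vars_def2)
  have "prob (\<Inter>j\<in>{..<m}. D j -` {d j} \<inter> space M) = (\<Prod>j<m. prob (D j -` {d j} \<inter> space M))"
    by (rule indep_setsD[OF ind]) (use assms(3) in auto)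
  moreover have "(\<Inter>j\<in>{..<m}. D j -` {d j} \<inter> space M) = {\<omega>\<in>space M. \<forall>j<m. D j \<omega> = d j}"
    using assms(3) by auto
  moreover have "D j -` {d j} \<inter> space M = {\<omega>\<in>space M. D j \<omega> = d j}" for j
    by auto
  ultimately show ?thesis
    using prob_increment[OF assms(1,2)] by (simp add: D_def)
qed

text \<open>Independence is used twice: between different clocks, and between the increments of one clock
  over the successive slots. The resulting double product is regrouped by slots.\<close>

lemma prob_word_event:
  assumes "0 < \<delta>" "w \<noteq> []" "set w \<subseteq> symbols"
  shows "prob (word_event \<delta> w) = word_prob \<delta> w"
proof -
  define m where "m = length w"
  have "0 < m" using assms(2) by (simp add: m_def)
  define P where "P = (PiM {0..} (\<lambda>_. count_space UNIV) :: (real \<Rightarrow> nat) measure)"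
  define Y where "Y = (\<lambda>i \<omega>. \<lambda>t\<in>{0..}. X i t \<omega>)"
  define B where "B = (\<lambda>i. {f\<in>space P. \<forall>j<m. f (real (Suc j) * \<delta>) - f (real j * \<delta>) = of_bool (w ! j = Some i)})"
  have B: "B i \<in> sets P" for i
  proof -
    have "{f\<in>space P. f (real (Suc j) * \<delta>) - f (real j * \<delta>) = of_bool (w ! j = Some i)} \<in> sets P" for j
    proof -
      have [measurable]: "(\<lambda>f. f (real (Suc j) * \<delta>)) \<in> P \<rightarrow>\<^sub>M count_space UNIV"
        "(\<lambda>f. f (real j * \<delta>)) \<in> P \<rightarrow>\<^sub>M count_space UNIV"
        unfolding P_def using assms(1) by (auto intro!: measurable_component_singleton)
      show ?thesis by measurable
    qed
    then show ?thesis
      unfolding B_def by (intro sets.sets_Collect_countable_All sets.sets_Collect_imp) auto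
  qed
  have "indep_vars (\<lambda>_. P) Y I"
    using driving unfolding independent_poisson_def P_def Y_def by blast
  then have ind: "indep_sets (\<lambda>i. {Y i -` A \<inter> space M |A. A \<in> sets P}) I"
    and Y: "\<And>i. i \<in> I \<Longrightarrow> Y i \<in> M \<rightarrow>\<^sub>M P"
    by (auto simp: indep_vars_def2)
  have *: "Y i -` B i \<inter> space M = {\<omega>\<in>space M. \<forall>j<m. X i (real (Suc j) * \<delta>) \<omega> - X i (real j * \<delta>) \<omega> = of_bool (w ! j = Some i)}"
    if "i \<in> I" for i
    using measurable_space[OF Y[OF that]] assms(1) by (auto simp: B_def Y_def)
  have "word_event \<delta> w = (\<Inter>i\<in>I. Y i -` B i \<inter> space M)"
    using * I_nonempty by (auto simp: word_event_def m_def)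
  also have "prob \<dots> = (\<Prod>i\<in>I. prob (Y i -` B i \<inter> space M))"
    by (rule indep_setsD[OF ind]) (use finite_I I_nonempty B in auto)
  also have "\<dots> = (\<Prod>i\<in>I. \<Prod>j<m. pmf (poisson_pmf (a i * \<delta>)) (of_bool (w ! j = Some i)))"
    using * prob_increments[OF _ assms(1) \<open>0 < m\<close>] by (intro prod.cong) auto
  also have "\<dots> = (\<Prod>j<m. \<Prod>i\<in>I. pmf (poisson_pmf (a i * \<delta>)) (of_bool (w ! j = Some i)))"
    by (rule prod.swap)
  also have "\<dots> = (\<Prod>j<m. symbol_prob \<delta> (w ! j))"
    using assms(3) by (intro prod.cong prod_poisson_symbol[OF _ assms(1)]) (auto simp: m_def)
  also have "\<dots> = word_prob \<delta> w"
    by (simp add: word_prob_def prod.list_conv_set_nth m_def atLeast0LessThan)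
  finally show ?thesis .
qed

lemma AE_good_path:
  assumes "h \<in> C"
  shows "AE \<omega> in M. (\<forall>i\<in>I. counting_path (\<lambda>t. X i t \<omega>)) \<and> H h 0 \<omega> = h \<and>
    slv (\<lambda>i t. X i t \<omega>) (\<lambda>t. H h t \<omega>) \<and> (\<forall>t\<ge>0. H h t \<omega> \<in> C)"
proof -
  have "AE \<omega> in M. counting_path (\<lambda>t. X i t \<omega>)" if "i \<in> I" for i
    using poisson[OF that] unfolding poisson_process_def counting_path_def by auto
  then have "AE \<omega> in M. \<forall>i\<in>I. counting_path (\<lambda>t. X i t \<omega>)"
    by (intro AE_finite_allI finite_I) auto
  moreover have "AE \<omega> in M. H h 0 \<omega> = h \<and> slv (\<lambda>i t. X i t \<omega>) (\<lambda>t. H h t \<omega>)"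
    using chain assms by (simp add: driven_chain_def)
  moreover have "AE \<omega> in M. \<forall>t\<ge>0. H h t \<omega> \<in> C"
    using H_in[OF assms] by (intro AE_I2) auto
  ultimately show ?thesis by auto
qed

text \<open>If every slot has at most one ring, the final state is obtained by reading the word.\<close>

lemma AE_word_event:
  assumes "h \<in> C" "0 < \<delta>" "set w \<subseteq> symbols"
  shows "AE \<omega> in M. \<omega> \<in> word_event \<delta> w \<longrightarrow> H h (real (length w) * \<delta>) \<omega> = fold act w h"
  using AE_good_path[OF assms(1)]
proof eventually_elim
  case (elim \<omega>)
  show ?case
  proof
    assume ev: "\<omega> \<in> word_event \<delta> w"
    have "H h (real j * \<delta>) \<omega> = fold act (take j w) h" if "j \<le> length w" for j
      using that
    proof (induction j)
      case 0
      then show ?case using elim by simp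
    next
      case (Suc j)
      then have j: "j < length w" by simp
      have "H h (real (Suc j) * \<delta>) \<omega> = act (w ! j) (H h (real j * \<delta>) \<omega>)"
      proof (rule step[where n = "\<lambda>i t. X i t \<omega>" and x = "\<lambda>t. H h t \<omega>"])
        show "w ! j \<in> symbols" using assms(3) j by auto
        fix i assume i: "i \<in> I"
        have "X i (real j * \<delta>) \<omega> \<le> X i (real (Suc j) * \<delta>) \<omega>"
          using elim i assms(2) by (intro counting_pathD(1)[of "\<lambda>t. X i t \<omega>"]) (auto simp: algebra_simps)
        moreover have "X i (real (Suc j) * \<delta>) \<omega> - X i (real j * \<delta>) \<omega> = of_bool (w ! j = Some i)"
          using ev i j by (simp add: word_event_def)
        ultimately show "X i (real (Suc j) * \<delta>) \<omega> = X i (real j * \<delta>) \<omega> + of_bool (w ! j = Some i)"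
          by linarith
      qed (use elim assms(2) in \<open>auto simp: algebra_simps\<close>)
      then show ?case
        using Suc j by (simp add: take_Suc_conv_app_nth)
    qed
    from this[of "length w"] show "H h (real (length w) * \<delta>) \<omega> = fold act w h"
      by simp
  qed
qed

lemma word_event_disjoint:
  assumes "w \<in> words n" "w' \<in> words n" "w \<noteq> w'"
  shows "word_event \<delta> w \<inter> word_event \<delta> w' = {}"
proof (rule ccontr)
  assume "word_event \<delta> w \<inter> word_event \<delta> w' \<noteq> {}"
  then obtain \<omega> where \<omega>: "\<omega> \<in> word_event \<delta> w" "\<omega> \<in> word_event \<delta> w'" by auto
  have "w ! j = w' ! j" if j: "j < n" for j
  proof -
    have "of_bool (w ! j = Some i) = (of_bool (w' ! j = Some i) :: nat)" if "i \<in> I" for i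
      using \<omega> that j assms(1,2) by (simp add: word_event_def words_def)
    then have iff: "w ! j = Some i \<longleftrightarrow> w' ! j = Some i" if "i \<in> I" for i
      using that by (metis of_bool_eq_iff)
    have "w ! j \<in> symbols" "w' ! j \<in> symbols"
      using assms(1,2) j by (auto simp: words_def)
    then show ?thesis
      unfolding symbols_def using iff by (metis imageE insertE)
  qed
  then have "w = w'"
    using assms(1,2) by (intro nth_equalityI) (auto simp: words_def)
  with assms(3) show False by simp
qed

text \<open>The chain goes from \<open>h\<close> to \<open>h'\<close> at least whenever the observed word leads from \<open>h\<close> to \<open>h'\<close>, and
  different words are observed on disjoint events.\<close>

lemma transition_lower:
  assumes "h \<in> C" "0 < \<delta>" "1 \<le> n"
  shows "(kernel \<delta> ^^ n) (\<lambda>g. of_bool (g = h')) h \<le> transition M H (real n * \<delta>) h h'"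
proof -
  define W where "W = {w\<in>words n. fold act w h = h'}"
  have finW: "finite W" using finite_words by (simp add: W_def)
  have W: "w \<noteq> []" "set w \<subseteq> symbols" "length w = n" "fold act w h = h'" if "w \<in> W" for w
    using that assms(3) by (auto simp: W_def words_def)
  have "(kernel \<delta> ^^ n) (\<lambda>g. of_bool (g = h')) h = (\<Sum>w\<in>W. word_prob \<delta> w)"
    unfolding kernel_pow_words W_def using finite_words
    by (simp add: sum.inter_filter of_bool_def if_distrib cong: if_cong)
  also have "\<dots> = (\<Sum>w\<in>W. prob (word_event \<delta> w))"
    using W assms(2) by (intro sum.cong refl prob_word_event[symmetric])
  also have "\<dots> = prob (\<Union>w\<in>W. word_event \<delta> w)"
  proof (rule finite_measure_finite_Union[symmetric, OF finW])
    show "word_event \<delta> ` W \<subseteq> events" using word_event_measurable assms(2) by auto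
    show "disjoint_family_on (word_event \<delta>) W"
      using word_event_disjoint[of _ n] by (auto simp: disjoint_family_on_def W_def)
  qed
  also have "\<dots> \<le> prob {\<omega>\<in>space M. H h (real n * \<delta>) \<omega> = h'}"
  proof (rule finite_measure_mono_AE)
    have "AE \<omega> in M. \<forall>w\<in>W. \<omega> \<in> word_event \<delta> w \<longrightarrow> H h (real n * \<delta>) \<omega> = h'"
    proof (intro AE_finite_allI finW)
      fix w assume "w \<in> W"
      then show "AE \<omega> in M. \<omega> \<in> word_event \<delta> w \<longrightarrow> H h (real n * \<delta>) \<omega> = h'"
        using AE_word_event[OF assms(1,2), of w] W by simp
    qed
    then show "AE \<omega> in M. \<omega> \<in> (\<Union>w\<in>W. word_event \<delta> w) \<longrightarrow> \<omega> \<in> {\<omega>\<in>space M. H h (real n * \<delta>) \<omega> = h'}"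
      using AE_space by eventually_elim auto
    show "{\<omega>\<in>space M. H h (real n * \<delta>) \<omega> = h'} \<in> events"
      using H_event assms by simp
  qed
  finally show ?thesis by (simp add: transition_def)
qed

lemma sum_transition:
  assumes "h \<in> C" "0 \<le> t"
  shows "(\<Sum>h'\<in>C. transition M H t h h') = 1"
proof -
  have "(\<Sum>h'\<in>C. transition M H t h h') = prob (\<Union>h'\<in>C. {\<omega>\<in>space M. H h t \<omega> = h'})"
    unfolding transition_def
    by (rule finite_measure_finite_Union[symmetric])
      (use finite_C H_event[OF assms] in \<open>auto simp: disjoint_family_on_def\<close>)
  also have "(\<Union>h'\<in>C. {\<omega>\<in>space M. H h t \<omega> = h'}) = space M"
    using H_in[OF assms] by auto
  finally show ?thesis by (simp add: prob_space)
qed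

text \<open>The lower bounds, summed over all targets \<open>h'\<close>, miss the total mass one only by the probability of
  a bad slot; therefore none of them is off by more than that.\<close>

lemma transition_upper:
  assumes "h \<in> C" "h' \<in> C" "0 < \<delta>" "1 \<le> n"
  shows "transition M H (real n * \<delta>) h h'
    \<le> (kernel \<delta> ^^ n) (\<lambda>g. of_bool (g = h')) h + (1 - single_prob \<delta> ^ n)"
proof -
  let ?d = "\<lambda>h'. transition M H (real n * \<delta>) h h' - (kernel \<delta> ^^ n) (\<lambda>g. of_bool (g = h')) h"
  have "?d h' \<le> (\<Sum>h'\<in>C. ?d h')"
    using transition_lower[OF assms(1,3,4)] by (intro member_le_sum assms(2) finite_C) simp
  also have "\<dots> = 1 - single_prob \<delta> ^ n"
    using sum_transition[OF assms(1), of "real n * \<delta>"] sum_kernel_pow[OF assms(1)] assms(3)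
    by (simp add: sum_subtractf)
  finally show ?thesis by simp
qed

lemma transition_0:
  assumes "h \<in> C"
  shows "transition M H 0 h h' = of_bool (h = h')"
proof -
  have AE: "AE \<omega> in M. H h 0 \<omega> = h"
    using AE_good_path[OF assms] by eventually_elim simp
  show ?thesis
  proof (cases "h = h'")
    case True
    then have "prob {\<omega>\<in>space M. H h 0 \<omega> = h'} = 1"
      using AE H_event[OF assms, of 0 h'] by (subst prob_eq_1) auto
    then show ?thesis using True by (simp add: transition_def)
  next
    case False
    then have "prob {\<omega>\<in>space M. H h 0 \<omega> = h'} = 0"
      using AE H_event[OF assms, of 0 h'] by (subst prob_eq_0) auto
    then show ?thesis using False by (simp add: transition_def)
  qed
qed

text \<open>The powers of the kernel satisfy detailed balance exactly, and they approximate the transition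
  probabilities as the slots get shorter.\<close>

lemma transition_reversible:
  assumes h: "h \<in> C" "h' \<in> C" and t: "0 \<le> t"
  shows "wt h * transition M H t h h' = wt h' * transition M H t h' h"
proof (cases "t = 0")
  case True
  then show ?thesis using transition_0 h by simp
next
  case False
  have le: "wt h * transition M H t h h' - wt h' * transition M H t h' h \<le> 0"
    if h: "h \<in> C" "h' \<in> C" for h h'
  proof (rule nonpos_if_le_over_n)
    fix n :: nat assume n: "1 \<le> n"
    define \<delta> where "\<delta> = t / real n"
    define k where "k = (\<lambda>h h'. (kernel \<delta> ^^ n) (\<lambda>g. of_bool (g = h')) h)"
    have \<delta>: "0 < \<delta>" "real n * \<delta> = t" using t False n by (auto simp: \<delta>_def)
    have sym: "wt h * k h h' = wt h' * k h' h"
      using kernel_pow_symmetric[where f = "\<lambda>g. of_bool (g = h)" and g = "\<lambda>g. of_bool (g = h')" and n = n and \<delta> = \<delta>]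
      by (simp add: inner_of_bool h k_def)
    have "transition M H t h h' \<le> k h h' + (total_rate * t)\<^sup>2 / real n"
      using transition_upper[OF h \<delta>(1) n] single_prob_pow_bound[OF t n] \<delta>(2)
      by (simp add: k_def \<delta>_def)
    then have "wt h * transition M H t h h' \<le> wt h * (k h h' + (total_rate * t)\<^sup>2 / real n)"
      using wt_pos[OF h(1)] by (intro mult_left_mono) auto
    moreover have "wt h' * k h' h \<le> wt h' * transition M H t h' h"
      using transition_lower[OF h(2) \<delta>(1) n, of h] wt_pos[OF h(2)] \<delta>(2)
      by (intro mult_left_mono) (auto simp: k_def)
    ultimately show "wt h * transition M H t h h' - wt h' * transition M H t h' h
        \<le> wt h * (total_rate * t)\<^sup>2 / real n"
      using sym by (simp add: algebra_simps)
  qed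
  show ?thesis using le[OF h] le[OF h(2,1)] by simp
qed

lemma expectation_eq_sum:
  assumes "set_pmf \<nu> \<subseteq> C"
  shows "measure_pmf.expectation \<nu> f = (\<Sum>h\<in>C. pmf \<nu> h * f h)"
  using assms by (subst integral_measure_pmf_real[OF finite_C]) (auto simp: mult.commute)

lemma sum_pmf_C: "set_pmf \<nu> \<subseteq> C \<Longrightarrow> (\<Sum>h\<in>C. pmf \<nu> h) = 1"
  using finite_C by (rule sum_pmf_eq_1)

text \<open>One slot of length \<open>t\<close> suffices here. Its kernel differs from the transition matrix by \<open>O(t\<^sup>2)\<close>, so
  invariance leaves only \<open>O(t)\<close> for the expectation of the generator; it holds for all small \<open>t\<close>.\<close>

lemma invariant_generator:
  assumes inv: "invariant_law C (transition M H) \<nu>" and h': "h' \<in> C"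
  shows "(\<Sum>h\<in>C. pmf \<nu> h * generator (\<lambda>g. of_bool (g = h')) h) = 0"
proof -
  define G where "G = (\<Sum>h\<in>C. pmf \<nu> h * generator (\<lambda>g. of_bool (g = h')) h)"
  have sub: "set_pmf \<nu> \<subseteq> C" using inv by (simp add: invariant_law_def)
  have bound: "\<bar>G\<bar> \<le> total_rate\<^sup>2 * exp total_rate / real n" if n: "1 \<le> n" for n
  proof -
    \<comment> \<open>\<open>e\<close> is the probability of at least two rings up to time \<open>t\<close>.\<close>
    define t where "t = 1 / real n"
    have t: "0 < t" "t \<le> 1" using n by (auto simp: t_def)
    define e where "e = 1 - single_prob t"
    have e: "0 \<le> e" "e \<le> (total_rate * t)\<^sup>2"
      using single_prob_bounds[of t] t by (auto simp: e_def)
    define S where "S = (\<Sum>h\<in>C. pmf \<nu> h * kernel t (\<lambda>g. of_bool (g = h')) h)"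
    have "(\<Sum>h\<in>C. pmf \<nu> h * transition M H t h h') = pmf \<nu> h'"
      using inv h' t expectation_eq_sum[OF sub, of "\<lambda>h. transition M H t h h'"]
      by (simp add: invariant_law_def)
    moreover have "S \<le> (\<Sum>h\<in>C. pmf \<nu> h * transition M H t h h')"
      unfolding S_def using transition_lower[of _ t 1 h'] t
      by (intro sum_mono mult_left_mono) auto
    moreover have "(\<Sum>h\<in>C. pmf \<nu> h * transition M H t h h')
        \<le> (\<Sum>h\<in>C. pmf \<nu> h * (kernel t (\<lambda>g. of_bool (g = h')) h + e))"
      using transition_upper[of _ h' t 1] t h'
      by (intro sum_mono mult_left_mono) (auto simp: e_def)
    moreover have "(\<Sum>h\<in>C. pmf \<nu> h * (kernel t (\<lambda>g. of_bool (g = h')) h + e)) = S + e"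
      using sum_pmf_C[OF sub]
      by (simp add: S_def distrib_left sum.distrib sum_distrib_right[symmetric])
    ultimately have S: "S \<le> pmf \<nu> h'" "pmf \<nu> h' \<le> S + e" by auto
    have "(\<Sum>h\<in>C. pmf \<nu> h * of_bool (h = h')) = (\<Sum>h\<in>C. if h = h' then pmf \<nu> h else 0)"
      by (intro sum.cong) auto
    then have at_h': "(\<Sum>h\<in>C. pmf \<nu> h * of_bool (h = h')) = pmf \<nu> h'"
      using h' by (simp add: sum.delta[OF finite_C])
    have "S = (\<Sum>h\<in>C. (1 - e) * (pmf \<nu> h * of_bool (h = h'))
        + exp (- total_rate * t) * t * (pmf \<nu> h * generator (\<lambda>g. of_bool (g = h')) h))"
      unfolding S_def kernel_eq by (intro sum.cong) (simp_all add: e_def algebra_simps)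
    also have "\<dots> = (1 - e) * pmf \<nu> h' + exp (- total_rate * t) * t * G"
      unfolding sum.distrib sum_distrib_left[symmetric] at_h' G_def ..
    finally have "S = (1 - e) * pmf \<nu> h' + exp (- total_rate * t) * t * G" .
    then have eq: "exp (- total_rate * t) * t * G = S - pmf \<nu> h' + e * pmf \<nu> h'"
      by (simp add: algebra_simps)
    moreover have "0 \<le> e * pmf \<nu> h'" "e * pmf \<nu> h' \<le> e"
      using e(1) pmf_le_1[of \<nu> h'] by (auto simp: mult_left_le)
    ultimately have "\<bar>exp (- total_rate * t) * t * G\<bar> \<le> e" using S by linarith
    then have "exp (- total_rate * t) * t * \<bar>G\<bar> \<le> (total_rate * t)\<^sup>2"
      using e(2) t(1) by (simp add: abs_mult)
    then have "exp (total_rate * t) * (exp (- total_rate * t) * t * \<bar>G\<bar>) \<le> exp (total_rate * t) * (total_rate * t)\<^sup>2"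
      by (intro mult_left_mono) auto
    then have "t * \<bar>G\<bar> \<le> t * (exp (total_rate * t) * total_rate\<^sup>2 * t)"
      by (simp add: exp_minus power2_eq_square mult_ac)
    then have "\<bar>G\<bar> \<le> exp (total_rate * t) * total_rate\<^sup>2 * t"
      using t(1) by simp
    also have "\<dots> \<le> exp total_rate * total_rate\<^sup>2 * t"
      using t total_rate_nonneg by (intro mult_right_mono) (auto simp: mult_left_le)
    finally show ?thesis by (simp add: t_def mult_ac)
  qed
  have "\<bar>G\<bar> \<le> 0"
    by (rule nonpos_if_le_over_n) (rule bound)
  then show ?thesis by (simp add: G_def)
qed

text \<open>The density of an invariant law with respect to the weight is harmonic, since the generator is
  symmetric for the weight.\<close>

lemma invariant_proportional:
  assumes inv: "invariant_law C (transition M H) \<nu>"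
  obtains c where "\<And>h. h \<in> C \<Longrightarrow> pmf \<nu> h = c * wt h"
proof -
  define u where "u = (\<lambda>h. pmf \<nu> h / wt h)"
  have \<nu>: "pmf \<nu> h = wt h * u h" if "h \<in> C" for h
    using wt_pos[OF that] by (simp add: u_def)
  have "generator u h' = 0" if h': "h' \<in> C" for h'
  proof -
    have "wt h' * generator u h' = inner (generator u) (\<lambda>g. of_bool (g = h'))"
      by (simp add: inner_of_bool h')
    also have "\<dots> = inner u (generator (\<lambda>g. of_bool (g = h')))"
      by (rule generator_symmetric[symmetric])
    also have "\<dots> = (\<Sum>h\<in>C. pmf \<nu> h * generator (\<lambda>g. of_bool (g = h')) h)"
      unfolding inner_def by (intro sum.cong) (simp_all add: \<nu>)
    also have "\<dots> = 0" by (rule invariant_generator[OF inv h'])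
    finally show ?thesis using wt_pos[OF h'] by simp
  qed
  then have "u h = u top_state" if "h \<in> C" for h
    using harmonic_constant that by blast
  then show thesis
    using \<nu> that[of "u top_state"] by (simp add: mult.commute)
qed

theorem unique_reversible_law:
  "\<exists>\<mu>. (set_pmf \<mu> \<subseteq> C \<and> (\<forall>h\<in>C. pmf \<mu> h = 1 / (\<Sum>g\<in>C. wt g) * wt h)) \<and>
     reversible_law C (transition M H) \<mu> \<and> invariant_law C (transition M H) \<mu> \<and>
     (\<forall>\<nu>. invariant_law C (transition M H) \<nu> \<longrightarrow> \<nu> = \<mu>)"
proof -
  define Z where "Z = (\<Sum>g\<in>C. wt g)"
  have Z: "0 < Z"
    unfolding Z_def using finite_C top_state_in wt_pos by (intro sum_pos) auto
  define f where "f = (\<lambda>h. if h \<in> C then wt h / Z else 0)"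
  have f_nonneg: "0 \<le> f h" for h
    using Z wt_pos by (simp add: f_def less_imp_le)
  have "(\<integral>\<^sup>+h. ennreal (f h) \<partial>count_space UNIV) = (\<Sum>h\<in>C. ennreal (f h))"
    by (rule nn_integral_count_space'[OF finite_C]) (auto simp: f_def)
  also have "\<dots> = ennreal (\<Sum>h\<in>C. f h)"
    using f_nonneg by (intro sum_ennreal) auto
  also have "(\<Sum>h\<in>C. f h) = 1"
    using Z by (simp add: f_def sum_divide_distrib[symmetric] Z_def)
  finally have one: "(\<integral>\<^sup>+h. ennreal (f h) \<partial>count_space UNIV) = 1" by simp
  define \<mu> where "\<mu> = embed_pmf f"
  have \<mu>: "pmf \<mu> h = f h" for h
    unfolding \<mu>_def by (rule pmf_embed_pmf[OF f_nonneg one])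
  have sub: "set_pmf \<mu> \<subseteq> C"
    by (auto simp: set_pmf_iff \<mu> f_def split: if_splits)
  have rev: "pmf \<mu> h * transition M H t h h' = pmf \<mu> h' * transition M H t h' h"
    if "h \<in> C" "h' \<in> C" "0 \<le> t" for h h' t
    using transition_reversible[OF that] that by (simp add: \<mu> f_def divide_simps)
  have "measure_pmf.expectation \<mu> (\<lambda>h. transition M H t h h') = pmf \<mu> h'" if "0 \<le> t" "h' \<in> C" for t h'
  proof -
    have "measure_pmf.expectation \<mu> (\<lambda>h. transition M H t h h') = (\<Sum>h\<in>C. pmf \<mu> h' * transition M H t h' h)"
      unfolding expectation_eq_sum[OF sub] using rev that by (intro sum.cong) auto
    then show ?thesis
      using sum_transition[OF that(2,1)] by (simp add: sum_distrib_left[symmetric])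
  qed
  then have inv: "invariant_law C (transition M H) \<mu>"
    using sub by (simp add: invariant_law_def)
  have "\<nu> = \<mu>" if \<nu>: "invariant_law C (transition M H) \<nu>" for \<nu>
  proof (rule pmf_eqI)
    fix h
    obtain c where c: "\<And>h. h \<in> C \<Longrightarrow> pmf \<nu> h = c * wt h"
      using invariant_proportional[OF \<nu>] by blast
    have sub\<nu>: "set_pmf \<nu> \<subseteq> C" using \<nu> by (simp add: invariant_law_def)
    have "(\<Sum>h\<in>C. c * wt h) = 1"
      using sum_pmf_C[OF sub\<nu>] c by simp
    then have "c * Z = 1" by (simp add: Z_def sum_distrib_left)
    then have "c = 1 / Z" using Z by (simp add: field_simps)
    then show "pmf \<nu> h = pmf \<mu> h"
      using c[of h] sub\<nu> by (cases "h \<in> C") (auto simp: \<mu> f_def pmf_eq_0_set_pmf)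
  qed
  moreover have "pmf \<mu> h = 1 / (\<Sum>g\<in>C. wt g) * wt h" if "h \<in> C" for h
    using that by (simp add: \<mu> f_def Z_def)
  moreover have "reversible_law C (transition M H) \<mu>"
    using rev sub by (simp add: reversible_law_def)
  ultimately show ?thesis
    using sub inv by blast
qed

end

section \<open>Lattice paths and their corners\<close>

text \<open>The tent function of height one carried by the two grid intervals adjacent to the \<open>k\<close>th grid point.
  Adding a multiple of it to a path moves one corner and leaves the other grid values unchanged.\<close>

definition bump :: "nat \<Rightarrow> nat \<Rightarrow> real \<Rightarrow> real" where
  "bump N k x = max 0 (1 - \<bar>2 * real N * x - real k\<bar>)"

definition eps :: "nat \<Rightarrow> real" where
  "eps N = 1 / sqrt (2 * real N)"

definition shift :: "nat \<Rightarrow> real \<Rightarrow> nat \<Rightarrow> (real \<Rightarrow> real) \<Rightarrow> real \<Rightarrow> real" where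
  "shift N c k h = (\<lambda>x\<in>{0..1}. h x + 2 * c * eps N * bump N k x)"

text \<open>The highest path of the state space, with its summit at one half, and the unique one that has no
  local minimum.\<close>

definition tent :: "nat \<Rightarrow> real \<Rightarrow> real" where
  "tent N = (\<lambda>x\<in>{0..1}. sqrt (2 * real N) * min x (1 - x))"

definition reflect :: "(real \<Rightarrow> real) \<Rightarrow> real \<Rightarrow> real" where
  "reflect h = (\<lambda>x\<in>{0..1}. - h x)"

text \<open>The potential behind irreducibility: flipping a local minimum increases it.\<close>

definition height :: "nat \<Rightarrow> (real \<Rightarrow> real) \<Rightarrow> real" where
  "height N h = (\<Sum>k=1..2 * N - 1. h (grid N k))"

lemma before_eq:
  assumes "s < \<sigma>" "\<And>r. s \<le> r \<Longrightarrow> r < \<sigma> \<Longrightarrow> x r = h"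
  shows "before x \<sigma> = h"
  unfolding before_def by (intro ext left_lim_eq[OF assms(1)]) (simp add: assms(2))

lemma grid_0: "grid N 0 = 0"
  by (simp add: grid_def)

lemma grid_end: "1 \<le> N \<Longrightarrow> grid N (2 * N) = 1"
  by (simp add: grid_def)

lemma grid_scale: "1 \<le> N \<Longrightarrow> 2 * real N * grid N k = real k"
  by (simp add: grid_def)

lemma grid_in: "1 \<le> N \<Longrightarrow> k \<le> 2 * N \<Longrightarrow> grid N k \<in> {0..1}"
  by (auto simp: grid_def divide_simps)

lemma grid_nonneg: "0 \<le> grid N k"
  by (simp add: grid_def)

lemma grid_piece:
  assumes "1 \<le> N" "1 \<le> j"
  shows "x \<in> {grid N (j - 1)..grid N j} \<longleftrightarrow> real j - 1 \<le> 2 * real N * x \<and> 2 * real N * x \<le> real j"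
  using assms by (auto simp: grid_def of_nat_diff field_simps)

lemma in_grid_piece:
  assumes "1 \<le> N" "x \<in> {0..1}"
  obtains j where "j \<in> {1..2 * N}" "x \<in> {grid N (j - 1)..grid N j}"
proof -
  define y where "y = 2 * real N * x"
  have y: "0 \<le> y" "y \<le> 2 * real N" using assms by (auto simp: y_def mult_left_le)
  define j where "j = max 1 (nat \<lceil>y\<rceil>)"
  have "j \<le> 2 * N" using y assms(1) by (auto simp: j_def)
  moreover have "1 \<le> j" by (simp add: j_def)
  moreover have "y \<le> real j" "real j - 1 \<le> y"
    using y unfolding j_def by linarith+
  ultimately show thesis
    using that[of j] grid_piece[OF assms(1), of j x] by (simp add: y_def)
qed

context
  fixes N :: nat
  assumes N: "1 \<le> N"
begin

abbreviation "\<epsilon> \<equiv> eps N"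

lemma eps_pos: "0 < \<epsilon>"
  using N by (simp add: eps_def)

lemma C1_step:
  assumes "h \<in> C1 N" "k \<in> {1..2 * N}"
  shows "h (grid N k) = h (grid N (k - 1)) + \<epsilon> \<or> h (grid N k) = h (grid N (k - 1)) - \<epsilon>"
  using assms by (simp add: C1_def eps_def)

lemma C1_ends: "h \<in> C1 N \<Longrightarrow> h (grid N 0) = 0" "h \<in> C1 N \<Longrightarrow> h (grid N (2 * N)) = 0"
  using grid_end[OF N] by (auto simp: C1_def grid_0)

lemma C1_interpolate:
  assumes h: "h \<in> C1 N" and j: "j \<in> {1..2 * N}" and x: "x \<in> {grid N (j - 1)..grid N j}"
  shows "h x = (real j - 2 * real N * x) * h (grid N (j - 1))
    + (2 * real N * x - (real j - 1)) * h (grid N j)"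
proof -
  have "\<exists>a b. \<forall>x\<in>{grid N (j - 1)..grid N j}. h x = a * x + b"
    using h j unfolding C1_def by blast
  then obtain a b where ab: "\<And>x. x \<in> {grid N (j - 1)..grid N j} \<Longrightarrow> h x = a * x + b"
    by blast
  have le: "grid N (j - 1) \<le> grid N j"
    using x by simp
  have "h (grid N (j - 1)) = a * grid N (j - 1) + b" "h (grid N j) = a * grid N j + b"
    by (rule ab, use le in simp)+
  moreover have "real j - 1 = 2 * real N * grid N (j - 1)" "real j = 2 * real N * grid N j"
    "2 * real N * grid N j - 2 * real N * grid N (j - 1) = 1"
    using j grid_scale[OF N] by (auto simp: of_nat_diff)
  moreover have "a * x + b = (v - 2 * real N * x) * (a * u' + b) + (2 * real N * x - u) * (a * v' + b)"
    if "u = 2 * real N * u'" "v = 2 * real N * v'" "v - u = 1" for u v u' v'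
  proof -
    have "(v - 2 * real N * x) * (a * u' + b) + (2 * real N * x - u) * (a * v' + b)
        = (v - u) * (a * x + b)"
      unfolding that(1,2) by (simp add: algebra_simps)
    then show ?thesis using that(3) by simp
  qed
  ultimately show ?thesis
    using ab[OF x] by simp
qed

lemma C1_eqI:
  assumes h: "h \<in> C1 N" and h': "h' \<in> C1 N"
    and eq: "\<And>k. k \<in> {1..2 * N - 1} \<Longrightarrow> h (grid N k) = h' (grid N k)"
  shows "h = h'"
proof (rule extensionalityI[of h "{0..1}"])
  show "h \<in> extensional {0..1}" "h' \<in> extensional {0..1}"
    using h h' by (auto simp: C1_def)
  fix x :: real assume "x \<in> {0..1}"
  then obtain j where j: "j \<in> {1..2 * N}" "x \<in> {grid N (j - 1)..grid N j}"
    using in_grid_piece[OF N] by blast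
  have eq': "h (grid N k) = h' (grid N k)" if "k \<le> 2 * N" for k
  proof -
    consider "k = 0" | "k = 2 * N" | "k \<in> {1..2 * N - 1}"
      using \<open>k \<le> 2 * N\<close> by fastforce
    then show ?thesis
      using C1_ends[OF h] C1_ends[OF h'] eq by cases simp_all
  qed
  have le: "j - 1 \<le> 2 * N" using j(1) by auto
  show "h x = h' x"
    unfolding C1_interpolate[OF h j] C1_interpolate[OF h' j]
    using eq'[of j] eq'[OF le] j(1) by simp
qed

lemma C1_le:
  assumes h: "h \<in> C1 N" and h': "h' \<in> C1 N" and x: "x \<in> {0..1}"
    and le: "\<And>k. k \<le> 2 * N \<Longrightarrow> h (grid N k) \<le> h' (grid N k)"
  shows "h x \<le> h' x"
proof -
  obtain j where j: "j \<in> {1..2 * N}" "x \<in> {grid N (j - 1)..grid N j}"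
    using in_grid_piece[OF N x] by blast
  have "real j - 1 \<le> 2 * real N * x" "2 * real N * x \<le> real j"
    using grid_piece[OF N, of j x] j by auto
  then show ?thesis
    unfolding C1_interpolate[OF h j] C1_interpolate[OF h' j]
    using le[of j] le[of "j - 1"] j(1) by (intro add_mono mult_left_mono) auto
qed

lemma C1_nonneg:
  assumes h: "h \<in> C1 N" and x: "x \<in> {0..1}"
    and le: "\<And>k. k \<le> 2 * N \<Longrightarrow> 0 \<le> h (grid N k)"
  shows "0 \<le> h x"
proof -
  obtain j where j: "j \<in> {1..2 * N}" "x \<in> {grid N (j - 1)..grid N j}"
    using in_grid_piece[OF N x] by blast
  have "real j - 1 \<le> 2 * real N * x" "2 * real N * x \<le> real j"
    using grid_piece[OF N, of j x] j by auto
  then show ?thesis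
    unfolding C1_interpolate[OF h j]
    using le[of j] le[of "j - 1"] j(1) by (intro add_nonneg_nonneg mult_nonneg_nonneg) auto
qed

lemma finite_C1: "finite (C1 N)"
proof -
  define rises where "rises = (\<lambda>h. {k\<in>{1..2 * N}. h (grid N (k - 1)) < (h (grid N k) :: real)})"
  have "inj_on rises (C1 N)"
  proof (rule inj_onI)
    fix h h' assume h: "h \<in> C1 N" and h': "h' \<in> C1 N" and eq: "rises h = rises h'"
    have "h (grid N k) = h' (grid N k)" if "k \<le> 2 * N" for k
      using that
    proof (induction k)
      case 0
      then show ?case using C1_ends[OF h] C1_ends[OF h'] by simp
    next
      case (Suc k)
      have "Suc k \<in> rises h \<longleftrightarrow> Suc k \<in> rises h'" using eq by simp
      then have "h (grid N k) < h (grid N (Suc k)) \<longleftrightarrow> h' (grid N k) < h' (grid N (Suc k))"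
        using Suc.prems by (simp add: rises_def)
      then show ?case
        using C1_step[OF h, of "Suc k"] C1_step[OF h', of "Suc k"] Suc eps_pos by auto
    qed
    then show "h = h'" by (intro C1_eqI[OF h h']) auto
  qed
  moreover have "finite (rises ` C1 N)"
    by (rule finite_subset[of _ "Pow {1..2 * N}"]) (auto simp: rises_def)
  ultimately show ?thesis
    by (rule finite_imageD[rotated])
qed

text \<open>The parity of a height in units of the step is that of its grid index. Hence two
  surfaces that differ at a grid point are at least two steps apart there, the size of a flip.\<close>

lemma C1_lattice:
  assumes h: "h \<in> C1 N" and "k \<le> 2 * N"
  shows "\<exists>m::int. h (grid N k) = (real k + 2 * of_int m) * \<epsilon>"
  using assms(2)
proof (induction k)
  case 0
  then show ?case using C1_ends[OF h] by (intro exI[of _ 0]) simp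
next
  case (Suc k)
  then obtain m :: int where m: "h (grid N k) = (real k + 2 * of_int m) * \<epsilon>" by auto
  from C1_step[OF h, of "Suc k"] Suc.prems
  consider "h (grid N (Suc k)) = h (grid N k) + \<epsilon>" | "h (grid N (Suc k)) = h (grid N k) - \<epsilon>"
    by auto
  then show ?case
  proof cases
    case 1
    then show ?thesis by (intro exI[of _ m]) (simp add: m algebra_simps)
  next
    case 2
    then show ?thesis by (intro exI[of _ "m - 1"]) (simp add: m algebra_simps)
  qed
qed

lemma C1_gap:
  assumes h: "h \<in> C1 N" and h': "h' \<in> C1 N" and "k \<le> 2 * N" and less: "h' (grid N k) < h (grid N k)"
  shows "h' (grid N k) + 2 * \<epsilon> \<le> h (grid N k)"
proof -
  obtain m m' :: int where m: "h (grid N k) = (real k + 2 * of_int m) * \<epsilon>"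
    "h' (grid N k) = (real k + 2 * of_int m') * \<epsilon>"
    using C1_lattice[OF h assms(3)] C1_lattice[OF h' assms(3)] by blast
  have "(real k + 2 * of_int m') * \<epsilon> < (real k + 2 * of_int m) * \<epsilon>"
    using less unfolding m .
  then have "m' < m"
    using eps_pos mult_less_cancel_right_pos[OF eps_pos] by auto
  then have "real k + 2 * of_int m' + 2 \<le> real k + 2 * of_int m" by linarith
  then have "(real k + 2 * of_int m' + 2) * \<epsilon> \<le> (real k + 2 * of_int m) * \<epsilon>"
    using eps_pos by (intro mult_right_mono) auto
  then show ?thesis unfolding m by (simp add: distrib_right)
qed

lemma C1_gap_one:
  assumes h: "h \<in> C1 N" and "k \<le> 2 * N" and less: "\<epsilon> < h (grid N k)"
  shows "2 * \<epsilon> \<le> h (grid N k)"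
proof -
  obtain m :: int where m: "h (grid N k) = (real k + 2 * of_int m) * \<epsilon>"
    using C1_lattice[OF h assms(2)] by blast
  have "1 * \<epsilon> < (real k + 2 * of_int m) * \<epsilon>" using less unfolding m by simp
  then have "1 < real k + 2 * of_int m"
    using mult_less_cancel_right_pos[OF eps_pos] by blast
  then have "1 < int k + 2 * m" by linarith
  then have "2 \<le> real k + 2 * of_int m" by linarith
  then show ?thesis unfolding m using eps_pos by (intro mult_right_mono) auto
qed

lemma laplacian_pos_iff:
  assumes "h \<in> C1 N" "k \<in> {1..2 * N - 1}"
  shows "0 < laplacian N h k \<longleftrightarrow>
    h (grid N (k - 1)) = h (grid N k) + \<epsilon> \<and> h (grid N (k + 1)) = h (grid N k) + \<epsilon>"
proof -
  have "k \<in> {1..2 * N}" "k + 1 \<in> {1..2 * N}" using assms(2) by auto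
  from this[THEN C1_step[OF assms(1)]] show ?thesis
    using eps_pos unfolding laplacian_def by auto
qed

lemma laplacian_neg_iff:
  assumes "h \<in> C1 N" "k \<in> {1..2 * N - 1}"
  shows "laplacian N h k < 0 \<longleftrightarrow>
    h (grid N (k - 1)) = h (grid N k) - \<epsilon> \<and> h (grid N (k + 1)) = h (grid N k) - \<epsilon>"
proof -
  have "k \<in> {1..2 * N}" "k + 1 \<in> {1..2 * N}" using assms(2) by auto
  from this[THEN C1_step[OF assms(1)]] show ?thesis
    using eps_pos unfolding laplacian_def by auto
qed

lemma laplacian_sign_cases:
  assumes "h \<in> C1 N" "k \<in> {1..2 * N - 1}" "c \<in> {1, -1}"
  shows "0 < c * laplacian N h k \<longleftrightarrow>
    h (grid N (k - 1)) = h (grid N k) + c * \<epsilon> \<and> h (grid N (k + 1)) = h (grid N k) + c * \<epsilon>"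
  using laplacian_pos_iff[OF assms(1,2)] laplacian_neg_iff[OF assms(1,2)] assms(3) by auto

lemma bump_grid: "bump N k (grid N j) = of_bool (j = k)"
proof (cases "j = k")
  case False
  then have "1 \<le> \<bar>real j - real k\<bar>" by linarith
  then show ?thesis using False by (simp add: bump_def grid_scale[OF N])
qed (simp add: bump_def grid_scale[OF N])

lemma shift_grid:
  "j \<le> 2 * N \<Longrightarrow> shift N c k h (grid N j) = h (grid N j) + of_bool (j = k) * (2 * c * \<epsilon>)"
  using grid_in[OF N, of j] by (simp add: shift_def bump_grid)

lemma shift_undo: "h \<in> C1 N \<Longrightarrow> c' = - c \<Longrightarrow> shift N c' k (shift N c k h) = h"
  by (auto simp: shift_def C1_def extensional_def fun_eq_iff)

text \<open>With \<open>c = 1\<close> a local minimum becomes a local maximum, with \<open>c = -1\<close> conversely; in both cases the two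
  steps adjacent to \<open>k\<close> are exchanged.\<close>

lemma shift_in_C1:
  assumes h: "h \<in> C1 N" and k: "k \<in> {1..2 * N - 1}" and c: "c \<in> {1, -1}"
    and flippable: "0 < c * laplacian N h k"
  shows "shift N c k h \<in> C1 N"
proof -
  have nb: "h (grid N (k - 1)) = h (grid N k) + c * \<epsilon>" "h (grid N (k + 1)) = h (grid N k) + c * \<epsilon>"
    using laplacian_sign_cases[OF h k c] flippable by auto
  have steps: "shift N c k h (grid N j) = shift N c k h (grid N (j - 1)) + \<epsilon>
      \<or> shift N c k h (grid N j) = shift N c k h (grid N (j - 1)) - \<epsilon>" if j: "j \<in> {1..2 * N}" for j
  proof -
    have "j \<le> 2 * N" "j - 1 \<le> 2 * N" using j by auto
    note g = this[THEN shift_grid, of c k h]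
    consider "j = k" | "j = k + 1" | "j \<noteq> k" "j - 1 \<noteq> k" using j by fastforce
    then show ?thesis
    proof cases
      case 1
      then show ?thesis unfolding g using nb c k by auto
    next
      case 2
      then show ?thesis unfolding g using nb c by auto
    next
      case 3
      then show ?thesis unfolding g using C1_step[OF h j] by auto
    qed
  qed
  have affine: "\<exists>a b. \<forall>x\<in>{grid N (j - 1)..grid N j}. shift N c k h x = a * x + b"
    if j: "j \<in> {1..2 * N}" for j
  proof -
    have "\<exists>a b. \<forall>x\<in>{grid N (j - 1)..grid N j}. h x = a * x + b"
      using h j unfolding C1_def by blast
    then obtain a b where ab: "\<And>x. x \<in> {grid N (j - 1)..grid N j} \<Longrightarrow> h x = a * x + b"
      by blast
    have piece: "real j - 1 \<le> 2 * real N * x \<and> 2 * real N * x \<le> real j"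
      if "x \<in> {grid N (j - 1)..grid N j}" for x
      using grid_piece[OF N, of j x] that j by simp
    have "\<exists>a' b'. \<forall>x\<in>{grid N (j - 1)..grid N j}. bump N k x = a' * x + b'"
    proof -
      consider "j = k" | "j = k + 1" | "j < k" | "k + 1 < j" by linarith
      then show ?thesis
      proof cases
        case 1
        then show ?thesis
          using piece by (intro exI[of _ "2 * real N"] exI[of _ "1 - real k"]) (force simp: bump_def)
      next
        case 2
        then show ?thesis
          using piece by (intro exI[of _ "- 2 * real N"] exI[of _ "1 + real k"]) (force simp: bump_def)
      next
        case 3
        then have "real j \<le> real k - 1" by linarith
        then show ?thesis
          using piece by (intro exI[of _ 0]) (force simp: bump_def)
      next
        case 4
        then have "real k + 1 \<le> real j - 1" by linarith
        then show ?thesis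
          using piece by (intro exI[of _ 0]) (force simp: bump_def)
      qed
    qed
    then obtain a' b' where ab': "\<And>x. x \<in> {grid N (j - 1)..grid N j} \<Longrightarrow> bump N k x = a' * x + b'"
      by blast
    have sub: "x \<in> {0..1}" if "x \<in> {grid N (j - 1)..grid N j}" for x
      using that grid_in[OF N, of j] grid_nonneg[of N "j - 1"] j by auto
    have "shift N c k h x = (a + (2 * c * eps N) * a') * x + (b + (2 * c * eps N) * b')"
      if "x \<in> {grid N (j - 1)..grid N j}" for x
      using ab[OF that] ab'[OF that] sub[OF that] by (simp only: shift_def restrict_apply if_True) (simp add: algebra_simps)
    then show ?thesis by blast
  qed
  have "shift N c k h 0 = 0" "shift N c k h 1 = 0"
    using shift_grid[of 0 c k h] shift_grid[of "2 * N" c k h] k C1_ends[OF h] grid_end[OF N]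
    by (auto simp: grid_0)
  moreover have "shift N c k h \<in> extensional {0..1}" by (simp add: shift_def)
  ultimately show ?thesis
    unfolding C1_def eps_def[symmetric] using steps affine by blast
qed

lemma laplacian_shift:
  assumes h: "h \<in> C1 N" and k: "k \<in> {1..2 * N - 1}" and c: "c \<in> {1, -1}"
    and flippable: "0 < c * laplacian N h k"
  shows "c * laplacian N (shift N c k h) k < 0"
proof -
  have nb: "h (grid N (k - 1)) = h (grid N k) + c * \<epsilon>" "h (grid N (k + 1)) = h (grid N k) + c * \<epsilon>"
    using laplacian_sign_cases[OF h k c] flippable by auto
  have "k \<le> 2 * N" "k - 1 \<le> 2 * N" "k + 1 \<le> 2 * N" "k - 1 \<noteq> k" using k by auto
  then have "laplacian N (shift N c k h) k = - 2 * c * \<epsilon>"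
    using nb by (simp only: laplacian_def shift_grid) simp
  then show ?thesis using c eps_pos by auto
qed

lemma height_shift:
  assumes "k \<in> {1..2 * N - 1}"
  shows "height N (shift N c k h) = height N h + 2 * c * \<epsilon>"
proof -
  have "height N (shift N c k h) = (\<Sum>j=1..2 * N - 1. h (grid N j) + of_bool (j = k) * (2 * c * \<epsilon>))"
    unfolding height_def by (intro sum.cong refl shift_grid) auto
  also have "\<dots> = height N h + (\<Sum>j=1..2 * N - 1. if j = k then 2 * c * \<epsilon> else 0)"
    unfolding height_def sum.distrib by (intro arg_cong2[where f = "(+)"] sum.cong) auto
  finally show ?thesis using assms by simp
qed

text \<open>The exponent \<open>3/2\<close> in the Gibbs weight is the one for which a flip at \<open>k\<close> changes the energy by the
  logarithm of the ratio of its two rates, independently of \<open>N\<close>.\<close>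

lemma area1_shift:
  assumes "k \<in> {1..2 * N - 1}"
  shows "(2 * real N) powr (3/2) * area1 N p q (shift N c k h)
    = (2 * real N) powr (3/2) * area1 N p q h + c * ln (p (grid N k) / q (grid N k))"
proof -
  let ?l = "\<lambda>j. ln (p (grid N j) / q (grid N j))"
  have "(\<Sum>j=1..2 * N - 1. ?l j * shift N c k h (grid N j))
      = (\<Sum>j=1..2 * N - 1. ?l j * h (grid N j) + (if j = k then ?l k * (2 * c * \<epsilon>) else 0))"
    by (intro sum.cong refl) (auto simp: shift_grid algebra_simps)
  also have "\<dots> = (\<Sum>j=1..2 * N - 1. ?l j * h (grid N j)) + ?l k * (2 * c * \<epsilon>)"
    using assms by (simp add: sum.distrib)
  finally have "area1 N p q (shift N c k h) = area1 N p q h + 1 / (4 * real N) * (?l k * (2 * c * \<epsilon>))"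
    unfolding area1_def by (simp only: distrib_left)
  moreover have "(2 * real N) powr (3/2) = 2 * real N * sqrt (2 * real N)"
  proof -
    have "(2 * real N) powr (3/2) = (2 * real N) powr (1 + 1/2)" by simp
    also have "\<dots> = (2 * real N) powr 1 * (2 * real N) powr (1/2)" by (rule powr_add)
    finally show ?thesis using N by (simp add: powr_half_sqrt)
  qed
  moreover have "sqrt (2 * real N) * \<epsilon> = 1"
    using N by (simp add: eps_def)
  ultimately show ?thesis
    using N by (simp add: algebra_simps)
qed

lemma tent_grid:
  assumes "k \<le> 2 * N"
  shows "tent N (grid N k) = min (real k) (2 * real N - real k) * \<epsilon>"
proof -
  have "sqrt (2 * real N) * (y / (2 * real N)) = y * \<epsilon>" for y
  proof -
    have "2 * real N = sqrt (2 * real N) * sqrt (2 * real N)" by simp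
    then show ?thesis using N by (simp add: eps_def field_simps)
  qed
  moreover have "1 - grid N k = (2 * real N - real k) / (2 * real N)"
    using N by (simp add: grid_def field_simps)
  moreover have "tent N (grid N k) = sqrt (2 * real N) * min (grid N k) (1 - grid N k)"
    using grid_in[OF N assms] by (simp add: tent_def)
  ultimately show ?thesis
    by (auto simp: min_def grid_def divide_simps)
qed

lemma tent_in_C1: "tent N \<in> C1 N"
proof -
  have "tent N (grid N k) = tent N (grid N (k - 1)) + \<epsilon> \<or> tent N (grid N k) = tent N (grid N (k - 1)) - \<epsilon>"
    if k: "k \<in> {1..2 * N}" for k
  proof -
    have "k \<le> 2 * N" "k - 1 \<le> 2 * N" using k by auto
    note g = this[THEN tent_grid]
    show ?thesis
    proof (cases "k \<le> N")
      case True
      then have "min (real k) (2 * real N - real k) = real (k - 1) + 1"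
        "min (real (k - 1)) (2 * real N - real (k - 1)) = real (k - 1)"
        using k by auto
      then show ?thesis unfolding g by (simp add: algebra_simps)
    next
      case False
      then have "min (real k) (2 * real N - real k) = 2 * real N - real k"
        "min (real (k - 1)) (2 * real N - real (k - 1)) = 2 * real N - real k + 1"
        using k by (auto simp: of_nat_diff)
      then show ?thesis unfolding g by (simp add: algebra_simps)
    qed
  qed
  moreover have "\<exists>a b. \<forall>x\<in>{grid N (k - 1)..grid N k}. tent N x = a * x + b"
    if k: "k \<in> {1..2 * N}" for k
  proof -
    have sub: "x \<in> {0..1} \<and> real k - 1 \<le> 2 * real N * x \<and> 2 * real N * x \<le> real k"
      if "x \<in> {grid N (k - 1)..grid N k}" for x
      using that grid_in[OF N, of k] grid_nonneg[of N "k - 1"] grid_piece[OF N, of k x] k by auto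
    show ?thesis
    proof (cases "k \<le> N")
      case True
      have "tent N x = sqrt (2 * real N) * x + 0" if "x \<in> {grid N (k - 1)..grid N k}" for x
      proof -
        have "2 * real N * x \<le> real N" using sub[OF that] True by linarith
        then have "x \<le> 1 - x" using N by (simp add: field_simps)
        then show ?thesis using sub[OF that] by (simp add: tent_def min_def)
      qed
      then show ?thesis by blast
    next
      case False
      have "tent N x = - sqrt (2 * real N) * x + sqrt (2 * real N)" if "x \<in> {grid N (k - 1)..grid N k}" for x
      proof -
        have "real N \<le> 2 * real N * x" using sub[OF that] False by linarith
        then have "1 - x \<le> x" using N by (simp add: field_simps)
        then show ?thesis using sub[OF that] by (simp add: tent_def min_def algebra_simps)
      qed
      then show ?thesis by blast
    qed
  qed
  moreover have "tent N 0 = 0" "tent N 1 = 0" "tent N \<in> extensional {0..1}"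
    by (simp_all add: tent_def)
  ultimately show ?thesis unfolding C1_def eps_def[symmetric] by blast
qed

text \<open>The first rise after a fall starts at a local minimum.\<close>

lemma local_min_between:
  assumes h: "h \<in> C1 N" and "1 \<le> i" "i < j" "j \<le> 2 * N"
    and fall: "h (grid N i) < h (grid N (i - 1))" and rise: "h (grid N (j - 1)) < h (grid N j)"
  shows "\<exists>k\<in>{1..2 * N - 1}. 0 < laplacian N h k"
  using assms(3,4) rise
proof (induction j rule: less_induct)
  case (less j)
  show ?case
  proof (cases "h (grid N (j - 1 - 1)) < h (grid N (j - 1))")
    case True
    then have "i \<noteq> j - 1" using fall by auto
    then show ?thesis using less.IH[of "j - 1"] less.prems True by auto
  next
    case False
    have j: "j - 1 \<in> {1..2 * N - 1}" using less.prems \<open>1 \<le> i\<close> by auto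
    have "h (grid N (j - 1)) < h (grid N (j - 1 - 1))"
      using C1_step[OF h, of "j - 1"] j False eps_pos by auto
    then have "0 < laplacian N h (j - 1)"
      using less.prems j by (simp add: laplacian_def)
    then show ?thesis using j by blast
  qed
qed

text \<open>Below the tent at \<open>k\<close>, the path is too low to have risen all the time up to \<open>k\<close> and too low to fall
  all the time after \<open>k\<close>. So it falls before it rises.\<close>

lemma exists_local_min:
  assumes h: "h \<in> C1 N" and "h \<noteq> tent N"
  shows "\<exists>k\<in>{1..2 * N - 1}. 0 < laplacian N h k"
proof -
  have no_fall: "h (grid N k) = real k * \<epsilon>" if "k \<le> 2 * N"
    "\<forall>i\<in>{1..k}. \<not> h (grid N i) < h (grid N (i - 1))" for k
    using that
  proof (induction k)
    case 0
    then show ?case using C1_ends[OF h] by simp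
  next
    case (Suc k)
    then have "\<not> h (grid N (Suc k)) < h (grid N k)" by (metis atLeastAtMost_iff diff_Suc_1 le_refl plus_1_eq_Suc le_add1)
    then have "h (grid N (Suc k)) = h (grid N k) + \<epsilon>"
      using C1_step[OF h, of "Suc k"] Suc.prems eps_pos by auto
    then show ?case using Suc by (simp add: algebra_simps)
  qed
  have no_rise: "h (grid N (2 * N - m)) = real m * \<epsilon>" if "m \<le> 2 * N"
    "\<forall>j\<in>{2 * N - m + 1..2 * N}. \<not> h (grid N (j - 1)) < h (grid N j)" for m
    using that
  proof (induction m)
    case 0
    then show ?case using C1_ends[OF h] by simp
  next
    case (Suc m)
    define j where "j = 2 * N - m"
    have j: "j \<in> {1..2 * N}" "j - 1 = 2 * N - Suc m" using Suc.prems by (auto simp: j_def)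
    have "j \<in> {2 * N - Suc m + 1..2 * N}" using Suc.prems(1) by (auto simp: j_def)
    then have "\<not> h (grid N (j - 1)) < h (grid N j)" using Suc.prems(2) by blast
    then have "h (grid N (j - 1)) = h (grid N j) + \<epsilon>"
      using C1_step[OF h j(1)] eps_pos by auto
    moreover have "h (grid N j) = real m * \<epsilon>"
    proof -
      have "{2 * N - m + 1..2 * N} \<subseteq> {2 * N - Suc m + 1..2 * N}" by auto
      then show ?thesis
        unfolding j_def using Suc.IH Suc.prems by (meson Suc_leD subsetD)
    qed
    ultimately show ?case unfolding j(2) by (simp add: algebra_simps)
  qed
  have upper: "h (grid N k) \<le> real k * \<epsilon>" if "k \<le> 2 * N" for k
    using that
  proof (induction k)
    case 0
    then show ?case using C1_ends[OF h] by simp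
  next
    case (Suc k)
    then show ?case using C1_step[OF h, of "Suc k"] eps_pos by (auto simp: algebra_simps)
  qed
  have upper': "h (grid N (2 * N - m)) \<le> real m * \<epsilon>" if "m \<le> 2 * N" for m
    using that
  proof (induction m)
    case 0
    then show ?case using C1_ends[OF h] by simp
  next
    case (Suc m)
    have "2 * N - Suc m = 2 * N - m - 1" "2 * N - m \<in> {1..2 * N}" using Suc.prems by auto
    then show ?case
      using C1_step[OF h, of "2 * N - m"] Suc eps_pos by (auto simp: algebra_simps)
  qed
  obtain k where k: "k \<in> {1..2 * N - 1}" "h (grid N k) \<noteq> tent N (grid N k)"
    using C1_eqI[OF h tent_in_C1] assms(2) by blast
  have k': "k \<le> 2 * N" "2 * N - (2 * N - k) = k" "real (2 * N - k) = 2 * real N - real k"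
    using k by (auto simp: of_nat_diff)
  have "h (grid N k) < tent N (grid N k)"
    using k(2) upper[OF k'(1)] upper'[of "2 * N - k"] k' by (simp add: tent_grid min_def split: if_splits)
  moreover have "tent N (grid N k) \<le> real k * \<epsilon>" "tent N (grid N k) \<le> (2 * real N - real k) * \<epsilon>"
    unfolding tent_grid[OF k'(1)] using eps_pos by (intro mult_right_mono; simp)+
  ultimately have ne: "h (grid N k) \<noteq> real k * \<epsilon>" "h (grid N k) \<noteq> (2 * real N - real k) * \<epsilon>"
    by linarith+
  obtain i where i: "i \<in> {1..k}" "h (grid N i) < h (grid N (i - 1))"
    using no_fall[OF k'(1)] ne(1) by blast
  obtain j where j: "j \<in> {k + 1..2 * N}" "h (grid N (j - 1)) < h (grid N j)"
    using no_rise[OF diff_le_self, of k, unfolded k'(2,3)] ne(2) by blast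
  show ?thesis
    using local_min_between[OF h, of i j] i j by auto
qed

lemma reflect_in_C1:
  assumes h: "h \<in> C1 N"
  shows "reflect h \<in> C1 N"
proof -
  have g: "reflect h (grid N k) = - h (grid N k)" if "k \<le> 2 * N" for k
    using grid_in[OF N that] by (simp add: reflect_def)
  have "reflect h (grid N k) = reflect h (grid N (k - 1)) + \<epsilon>
      \<or> reflect h (grid N k) = reflect h (grid N (k - 1)) - \<epsilon>" if k: "k \<in> {1..2 * N}" for k
  proof -
    have "k \<le> 2 * N" "k - 1 \<le> 2 * N" using k by auto
    then show ?thesis using C1_step[OF h k] g by auto
  qed
  moreover have "\<exists>a b. \<forall>x\<in>{grid N (k - 1)..grid N k}. reflect h x = a * x + b"
    if k: "k \<in> {1..2 * N}" for k
  proof -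
    have "\<exists>a b. \<forall>x\<in>{grid N (k - 1)..grid N k}. h x = a * x + b"
      using h k unfolding C1_def by blast
    then obtain a b where ab: "\<And>x. x \<in> {grid N (k - 1)..grid N k} \<Longrightarrow> h x = a * x + b"
      by blast
    have "reflect h x = (- a) * x + (- b)" if x: "x \<in> {grid N (k - 1)..grid N k}" for x
    proof -
      have "x \<in> {0..1}"
        using x grid_in[OF N, of k] grid_nonneg[of N "k - 1"] k by auto
      then show ?thesis using ab[OF x] by (simp add: reflect_def)
    qed
    then show ?thesis by blast
  qed
  moreover have "reflect h 0 = 0" "reflect h 1 = 0" "reflect h \<in> extensional {0..1}"
    using h by (auto simp: reflect_def C1_def)
  ultimately show ?thesis unfolding C1_def eps_def[symmetric] by blast
qed

lemma reflect_reflect: "h \<in> C1 N \<Longrightarrow> reflect (reflect h) = h"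
  by (auto simp: reflect_def C1_def extensional_def fun_eq_iff)

lemma laplacian_reflect:
  assumes "k \<in> {1..2 * N - 1}"
  shows "laplacian N (reflect h) k = - laplacian N h k"
proof -
  have "reflect h (grid N j) = - h (grid N j)" if "j \<le> 2 * N" for j
    using grid_in[OF N that] by (simp add: reflect_def)
  moreover have "k - 1 \<le> 2 * N" "k \<le> 2 * N" "k + 1 \<le> 2 * N" using assms by auto
  ultimately show ?thesis by (simp add: laplacian_def)
qed

lemma exists_local_max:
  assumes h: "h \<in> C1 N" and "h \<noteq> reflect (tent N)"
  shows "\<exists>k\<in>{1..2 * N - 1}. laplacian N h k < 0"
proof -
  have "reflect h \<noteq> tent N" using assms reflect_reflect by metis
  then show ?thesis
    using exists_local_min[OF reflect_in_C1[OF h]] laplacian_reflect by fastforce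
qed

lemma tent_nonneg: "x \<in> {0..1} \<Longrightarrow> 0 \<le> tent N x"
  by (simp add: tent_def)

end

section \<open>The one-surface and two-surface models\<close>

text \<open>The guard \<open>g\<close> is the additional condition under which a local maximum may be flipped; it is trivial for
  free paths and keeps the path above the wall otherwise.\<close>

fun flip1 :: "nat \<Rightarrow> (nat \<Rightarrow> (real \<Rightarrow> real) \<Rightarrow> bool) \<Rightarrow> clock \<Rightarrow> (real \<Rightarrow> real) \<Rightarrow> real \<Rightarrow> real" where
  "flip1 N g (L k) h = (if 0 < laplacian N h k then shift N 1 k h else h)"
| "flip1 N g (R k) h = (if laplacian N h k < 0 \<and> g k h then shift N (- 1) k h else h)"

fun undo1 :: "clock \<Rightarrow> clock" where
  "undo1 (L k) = R k"
| "undo1 (R k) = L k"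

fun flip2 :: "nat \<Rightarrow> clock2 \<Rightarrow> (real \<Rightarrow> real) \<times> (real \<Rightarrow> real) \<Rightarrow> (real \<Rightarrow> real) \<times> (real \<Rightarrow> real)" where
  "flip2 N (L1 k) (h1, h2) = (if 0 < laplacian N h1 k then shift N 1 k h1 else h1, h2)"
| "flip2 N (R1 k) (h1, h2) =
    (if laplacian N h1 k < 0 \<and> h2 (grid N k) < h1 (grid N k) then shift N (- 1) k h1 else h1, h2)"
| "flip2 N (L2 k) (h1, h2) =
    (h1, if 0 < laplacian N h2 k \<and> h2 (grid N k) < h1 (grid N k) then shift N 1 k h2 else h2)"
| "flip2 N (R2 k) (h1, h2) = (h1, if laplacian N h2 k < 0 then shift N (- 1) k h2 else h2)"

fun undo2 :: "clock2 \<Rightarrow> clock2" where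
  "undo2 (L1 k) = R1 k"
| "undo2 (R1 k) = L1 k"
| "undo2 (L2 k) = R2 k"
| "undo2 (R2 k) = L2 k"

lemma weight_pos: "0 < weight N A h"
  by (simp add: weight_def)

lemma weight_area2: "weight N (area2 N p q) (h1, h2) = weight N (area1 N p q) h1 / weight N (area1 N p q) h2"
proof -
  have "area2 N p q (h1, h2) = area1 N p q h1 - area1 N p q h2"
    by (simp add: area2_def area1_def right_diff_distrib sum_subtractf)
  then show ?thesis by (simp add: weight_def right_diff_distrib exp_diff)
qed

context
  fixes N :: nat and p q :: "real \<Rightarrow> real"
  assumes N: "1 \<le> N"
    and rates: "\<And>k. k \<in> {1..2 * N - 1} \<Longrightarrow> 0 < p (grid N k) \<and> 0 < q (grid N k)"
begin

lemma weight_shift_up: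
  assumes k: "k \<in> {1..2 * N - 1}"
  shows "weight N (area1 N p q) h * p (grid N k) = weight N (area1 N p q) (shift N 1 k h) * q (grid N k)"
  using rates[OF k] by (simp add: weight_def area1_shift[OF N k] exp_add)

lemma weight_shift_down:
  assumes k: "k \<in> {1..2 * N - 1}"
  shows "weight N (area1 N p q) h * q (grid N k) = weight N (area1 N p q) (shift N (- 1) k h) * p (grid N k)"
  using rates[OF k] by (simp add: weight_def area1_shift[OF N k] exp_diff)

lemma shift_up_undo:
  assumes "h \<in> C1 N" "k \<in> {1..2 * N - 1}" "0 < laplacian N h k"
  shows "laplacian N (shift N 1 k h) k < 0" "shift N (- 1) k (shift N 1 k h) = h"
  using laplacian_shift[OF N assms(1,2), of 1] shift_undo[OF N assms(1), of "- 1" 1] assms(3) by auto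

lemma shift_down_undo:
  assumes "h \<in> C1 N" "k \<in> {1..2 * N - 1}" "laplacian N h k < 0"
  shows "0 < laplacian N (shift N (- 1) k h) k" "shift N 1 k (shift N (- 1) k h) = h"
  using laplacian_shift[OF N assms(1,2), of "- 1"] shift_undo[OF N assms(1), of 1 "- 1"] assms(3) by auto

text \<open>The assumptions on the guard say that it holds after every flip upwards, so that the flip can be undone,
  and that flips it permits do not leave the state space. Every path reaches the tent by flips
  upwards.\<close>

theorem one_surface_model:
  assumes C: "C \<subseteq> C1 N" and tent: "tent N \<in> C"
    and up: "\<And>h k. h \<in> C \<Longrightarrow> k \<in> {1..2 * N - 1} \<Longrightarrow> 0 < laplacian N h k \<Longrightarrow>
      shift N 1 k h \<in> C \<and> g k (shift N 1 k h)"
    and down: "\<And>h k. h \<in> C \<Longrightarrow> k \<in> {1..2 * N - 1} \<Longrightarrow> laplacian N h k < 0 \<Longrightarrow> g k h \<Longrightarrow>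
      shift N (- 1) k h \<in> C"
    and slv: "\<And>n x. slv n x \<Longrightarrow> \<forall>t\<ge>0. \<forall>k\<in>{1..2 * N - 1}.
      x t (grid N k) = x 0 (grid N k) + 2 / sqrt (2 * real N) *
        (count_integral (n (L k)) (\<lambda>s. 0 < laplacian N (before x s) k) t
       - count_integral (n (R k)) (\<lambda>s. laplacian N (before x s) k < 0 \<and> g k (before x s)) t)"
    and driving: "independent_poisson M (clocks N) (rate N p q) X" and chain: "driven_chain M C slv X H"
  shows "\<exists>\<mu>. gibbs_law N C (area1 N p q) \<mu> \<and> reversible_law C (transition M H) \<mu> \<and>
    invariant_law C (transition M H) \<mu> \<and> (\<forall>\<nu>. invariant_law C (transition M H) \<nu> \<longrightarrow> \<nu> = \<mu>)"
proof -
  have inC1: "h \<in> C1 N" if "h \<in> C" for h using C that by blast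
  interpret flip_dynamics C "clocks N" "flip1 N g" undo1 "rate N p q" "weight N (area1 N p q)" "tent N" "height N"
  proof
    show "finite C" using finite_C1[OF N] C finite_subset by blast
    show "finite (clocks N)" "clocks N \<noteq> {}" using N by (auto simp: clocks_def)
    show "0 < rate N p q i" if "i \<in> clocks N" for i
      using that rates by (auto simp: clocks_def)
    show "0 < weight N (area1 N p q) h" for h by (rule weight_pos)
    show "flip1 N g i h \<in> C" if "i \<in> clocks N" "h \<in> C" for i h
      using that up down by (auto simp: clocks_def)
    show "undo1 i \<in> clocks N" "undo1 (undo1 i) = i" if "i \<in> clocks N" for i
      using that by (auto simp: clocks_def)
    show "flip1 N g (undo1 i) (flip1 N g i h) = h" if "i \<in> clocks N" "h \<in> C" "flip1 N g i h \<noteq> h" for i h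
      using that up shift_up_undo[OF inC1[OF that(2)]] shift_down_undo[OF inC1[OF that(2)]]
      by (auto simp: clocks_def split: if_splits)
    show "weight N (area1 N p q) h * rate N p q i = weight N (area1 N p q) (flip1 N g i h) * rate N p q (undo1 i)"
      if "i \<in> clocks N" "h \<in> C" "flip1 N g i h \<noteq> h" for i h
      using that weight_shift_up weight_shift_down by (auto simp: clocks_def split: if_splits)
    show "tent N \<in> C" by (rule tent)
    show "\<exists>i\<in>clocks N. height N h < height N (flip1 N g i h)" if h: "h \<in> C" "h \<noteq> tent N" for h
    proof -
      obtain k where k: "k \<in> {1..2 * N - 1}" "0 < laplacian N h k"
        using exists_local_min[OF N inC1[OF h(1)] h(2)] by blast
      then have "height N h < height N (flip1 N g (L k) h)"
        using eps_pos[OF N] by (simp add: height_shift[OF N])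
      moreover have "L k \<in> clocks N" using k(1) by (auto simp: clocks_def)
      ultimately show ?thesis by blast
    qed
  qed
  interpret driven_flips C "clocks N" "flip1 N g" undo1 "rate N p q" "weight N (area1 N p q)" "tent N" "height N"
    M X H slv
  proof
    show "independent_poisson M (clocks N) (rate N p q) X" "driven_chain M C slv X H"
      by (rule driving, rule chain)
    fix n :: "clock \<Rightarrow> real \<Rightarrow> nat" and x s t z
    assume n: "slv n x" "\<And>i. i \<in> clocks N \<Longrightarrow> counting_path (n i)"
      and x: "\<And>t. 0 \<le> t \<Longrightarrow> x t \<in> C" and st: "0 \<le> s" "s \<le> t" and z: "z \<in> symbols"
      and jump: "\<And>i. i \<in> clocks N \<Longrightarrow> n i t = n i s + of_bool (z = Some i)"
    have upd: "x t (grid N k) = x s (grid N k) + 2 / sqrt (2 * real N) *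
      (of_bool (z = Some (L k) \<and> 0 < laplacian N (x s) k)
       - of_bool (z = Some (R k) \<and> laplacian N (x s) k < 0 \<and> g k (x s)))"
      if k: "k \<in> {1..2 * N - 1}" for k
    proof (rule one_jump_update[where obs = "\<lambda>k h. h (grid N k)" and K = "{1..2 * N - 1}" and C = C
          and up = L and dn = R and A = "\<lambda>k h. 0 < laplacian N h k"
          and B = "\<lambda>k h. laplacian N h k < 0 \<and> g k h" and xm = "before x" and n = n and I = "clocks N"
          and x = x and s = s and t = t and z = z and k = k and c = "2 / sqrt (2 * real N)"])
      show "x t (grid N k) = x 0 (grid N k) + 2 / sqrt (2 * real N) *
        (count_integral (n (L k)) (\<lambda>s. 0 < laplacian N (before x s) k) t
       - count_integral (n (R k)) (\<lambda>s. laplacian N (before x s) k < 0 \<and> g k (before x s)) t)"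
        if "0 \<le> t" "k \<in> {1..2 * N - 1}" for t k
        using slv[OF n(1)] that by blast
      show "h = h'" if "h \<in> C" "h' \<in> C" "\<And>k. k \<in> {1..2 * N - 1} \<Longrightarrow> h (grid N k) = h' (grid N k)" for h h'
        using C1_eqI[OF N inC1[OF that(1)] inC1[OF that(2)] that(3)] .
      show "before x \<sigma> = h" if "s < \<sigma>" "\<And>r. s \<le> r \<Longrightarrow> r < \<sigma> \<Longrightarrow> x r = h" for s \<sigma> h
        by (rule before_eq[OF that])
      show "L k \<in> clocks N \<and> R k \<in> clocks N" if "k \<in> {1..2 * N - 1}" for k
        using that by (auto simp: clocks_def)
    qed (fact x n st jump k)+
    show "x t = act z (x s)"
    proof (rule C1_eqI[OF N])
      show "x t \<in> C1 N" using x st inC1 by simp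
      show "act z (x s) \<in> C1 N" using act_closed[OF z x] st inC1 by simp
      fix k assume k: "k \<in> {1..2 * N - 1}"
      then have k': "k \<le> 2 * N" by auto
      consider "z = None" | j where "z = Some (L j)" | j where "z = Some (R j)"
        using clock.exhaust option.exhaust by metis
      then show "x t (grid N k) = act z (x s) (grid N k)"
        unfolding upd[OF k] by cases (auto simp: act_def shift_grid[OF N k'] eps_def)
    qed
  qed
  show ?thesis
    using unique_reversible_law unfolding gibbs_law_def .
qed

lemma C2_iff:
  "(h1, h2) \<in> C2 N \<longleftrightarrow> h1 \<in> C1 N \<and> h2 \<in> C1 N \<and> (\<forall>k\<le>2 * N. h2 (grid N k) \<le> h1 (grid N k))"
proof (intro iffI conjI)
  assume "(h1, h2) \<in> C2 N"
  then show "h1 \<in> C1 N" "h2 \<in> C1 N" "\<forall>k\<le>2 * N. h2 (grid N k) \<le> h1 (grid N k)"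
    using grid_in[OF N] by (auto simp: C2_def)
next
  assume "h1 \<in> C1 N \<and> h2 \<in> C1 N \<and> (\<forall>k\<le>2 * N. h2 (grid N k) \<le> h1 (grid N k))"
  then show "(h1, h2) \<in> C2 N"
    using C1_le[OF N, of h2 h1] by (simp add: C2_def)
qed

lemma C2_shift:
  assumes h: "(h1, h2) \<in> C2 N" and k: "k \<in> {1..2 * N - 1}"
  shows "0 < laplacian N h1 k \<Longrightarrow> (shift N 1 k h1, h2) \<in> C2 N"
    and "laplacian N h2 k < 0 \<Longrightarrow> (h1, shift N (- 1) k h2) \<in> C2 N"
    and "laplacian N h1 k < 0 \<Longrightarrow> h2 (grid N k) < h1 (grid N k) \<Longrightarrow> (shift N (- 1) k h1, h2) \<in> C2 N"
    and "0 < laplacian N h2 k \<Longrightarrow> h2 (grid N k) < h1 (grid N k) \<Longrightarrow> (h1, shift N 1 k h2) \<in> C2 N"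
proof -
  have h': "h1 \<in> C1 N" "h2 \<in> C1 N" and le: "\<And>j. j \<le> 2 * N \<Longrightarrow> h2 (grid N j) \<le> h1 (grid N j)"
    using h by (auto simp: C2_iff)
  have k': "k \<le> 2 * N" using k by auto
  have shift: "shift N 1 k h \<in> C1 N" if "h \<in> C1 N" "0 < laplacian N h k" for h
    using shift_in_C1[OF N that(1) k, of 1] that by simp
  have shift': "shift N (- 1) k h \<in> C1 N" if "h \<in> C1 N" "laplacian N h k < 0" for h
    using shift_in_C1[OF N that(1) k, of "- 1"] that by simp
  show "0 < laplacian N h1 k \<Longrightarrow> (shift N 1 k h1, h2) \<in> C2 N"
    using h' shift le eps_pos[OF N] by (auto simp: C2_iff shift_grid[OF N] add_increasing2)
  show "laplacian N h2 k < 0 \<Longrightarrow> (h1, shift N (- 1) k h2) \<in> C2 N"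
    using h' shift' le le[OF k'] eps_pos[OF N] by (auto simp: C2_iff shift_grid[OF N])
  show "laplacian N h1 k < 0 \<Longrightarrow> h2 (grid N k) < h1 (grid N k) \<Longrightarrow> (shift N (- 1) k h1, h2) \<in> C2 N"
    using h' shift' le C1_gap[OF N h' k'] by (auto simp: C2_iff shift_grid[OF N])
  show "0 < laplacian N h2 k \<Longrightarrow> h2 (grid N k) < h1 (grid N k) \<Longrightarrow> (h1, shift N 1 k h2) \<in> C2 N"
    using h' shift le C1_gap[OF N h' k'] by (auto simp: C2_iff shift_grid[OF N])
qed

text \<open>The weight is the quotient of the one-surface weights of the two components, and in exchange the two
  rates are swapped for the lower surface. The two outward flips, upwards for the upper surface and
  downwards for the lower one, are never blocked; they lead every pair to the tent and its reflection.\<close>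

theorem two_surface_model:
  assumes driving: "independent_poisson M (clocks2 N) (rate2 N p q) X"
    and chain: "driven_chain M (C2 N) (solves2 N) X H"
  shows "\<exists>\<mu>. gibbs_law N (C2 N) (area2 N p q) \<mu> \<and> reversible_law (C2 N) (transition M H) \<mu> \<and>
    invariant_law (C2 N) (transition M H) \<mu> \<and>
    (\<forall>\<nu>. invariant_law (C2 N) (transition M H) \<nu> \<longrightarrow> \<nu> = \<mu>)"
proof -
  let ?W = "weight N (area1 N p q)"
  let ?V = "\<lambda>h. height N (fst h) - height N (snd h)"
  have inC1: "h1 \<in> C1 N" "h2 \<in> C1 N" if "(h1, h2) \<in> C2 N" for h1 h2
    using that by (auto simp: C2_iff)
  have Wpos: "0 < ?W h" for h by (rule weight_pos)
  interpret flip_dynamics "C2 N" "clocks2 N" "flip2 N" undo2 "rate2 N p q" "weight N (area2 N p q)"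
    "(tent N, reflect (tent N))" ?V
  proof
    show "finite (C2 N)"
      by (rule finite_subset[of _ "C1 N \<times> C1 N"]) (use finite_C1[OF N] in \<open>auto simp: C2_def\<close>)
    show "finite (clocks2 N)" "clocks2 N \<noteq> {}" using N by (auto simp: clocks2_def)
    show "0 < rate2 N p q i" if "i \<in> clocks2 N" for i
      using that rates by (auto simp: clocks2_def)
    show "0 < weight N (area2 N p q) h" for h by (rule weight_pos)
    show "flip2 N i h \<in> C2 N" if "i \<in> clocks2 N" "h \<in> C2 N" for i h
    proof -
      obtain h1 h2 where h: "h = (h1, h2)" by fastforce
      show ?thesis
        using that C2_shift[of h1 h2] unfolding h by (auto simp: clocks2_def)
    qed
    show "undo2 i \<in> clocks2 N" "undo2 (undo2 i) = i" if "i \<in> clocks2 N" for i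
      using that by (auto simp: clocks2_def)
    show "flip2 N (undo2 i) (flip2 N i h) = h" if "i \<in> clocks2 N" "h \<in> C2 N" "flip2 N i h \<noteq> h" for i h
    proof -
      obtain h1 h2 where h: "h = (h1, h2)" by fastforce
      have h': "h1 \<in> C1 N" "h2 \<in> C1 N" using that(2) inC1 unfolding h by auto
      have le: "h2 (grid N k) \<le> h1 (grid N k)" if "k \<in> {1..2 * N - 1}" for k
      proof -
        have "k \<le> 2 * N" using that by auto
        then show ?thesis using \<open>h \<in> C2 N\<close> unfolding h C2_iff by blast
      qed
      have sg: "shift N c k f (grid N k) = f (grid N k) + 2 * c * eps N"
        if "k \<in> {1..2 * N - 1}" for c k f
      proof -
        have "k \<le> 2 * N" using that by auto
        then show ?thesis by (simp add: shift_grid[OF N])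
      qed
      from that(1) consider k where "k \<in> {1..2 * N - 1}" "i = L1 k" | k where "k \<in> {1..2 * N - 1}" "i = R1 k"
        | k where "k \<in> {1..2 * N - 1}" "i = L2 k" | k where "k \<in> {1..2 * N - 1}" "i = R2 k"
        by (auto simp: clocks2_def)
      then show ?thesis
      proof cases
        case (1 k)
        \<comment> \<open>An outward flip leaves the surfaces strictly apart, so the opposite flip is not blocked.\<close>
        have "0 < laplacian N h1 k" using that(3) unfolding h 1(2) by (auto split: if_splits)
        moreover have "h2 (grid N k) < h1 (grid N k) + 2 * eps N"
          using le[OF 1(1)] eps_pos[OF N] by linarith
        ultimately show ?thesis
          unfolding h 1(2) using shift_up_undo[OF h'(1) 1(1)] by (simp add: sg[OF 1(1)])
      next
        case (2 k)
        have "laplacian N h1 k < 0 \<and> h2 (grid N k) < h1 (grid N k)"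
          using that(3) unfolding h 2(2) by (auto split: if_splits)
        then show ?thesis
          unfolding h 2(2) using shift_down_undo[OF h'(1) 2(1)] by simp
      next
        case (3 k)
        have "0 < laplacian N h2 k \<and> h2 (grid N k) < h1 (grid N k)"
          using that(3) unfolding h 3(2) by (auto split: if_splits)
        then show ?thesis
          unfolding h 3(2) using shift_up_undo[OF h'(2) 3(1)] by simp
      next
        case (4 k)
        have "laplacian N h2 k < 0" using that(3) unfolding h 4(2) by (auto split: if_splits)
        moreover have "h2 (grid N k) - 2 * eps N < h1 (grid N k)"
          using le[OF 4(1)] eps_pos[OF N] by linarith
        ultimately show ?thesis
          unfolding h 4(2) using shift_down_undo[OF h'(2) 4(1)] by (simp add: sg[OF 4(1)])
      qed
    qed
    show "weight N (area2 N p q) h * rate2 N p q i = weight N (area2 N p q) (flip2 N i h) * rate2 N p q (undo2 i)"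
      if "i \<in> clocks2 N" "h \<in> C2 N" "flip2 N i h \<noteq> h" for i h
    proof -
      obtain h1 h2 where h: "h = (h1, h2)" by fastforce
      have div1: "u / ?W h2 * r = u' / ?W h2 * r'" if "u * r = u' * r'" for u u' r r'
        using that by simp
      have div2: "?W h1 / u * r = ?W h1 / u' * r'" if "u * r' = u' * r" "0 < u" "0 < u'" for u u' r r'
      proof -
        have "r * u' = r' * u" using that(1) by (simp add: mult.commute)
        then have "r / u = r' / u'" using that(2,3) by (simp add: frac_eq_eq)
        then have "?W h1 * (r / u) = ?W h1 * (r' / u')" by simp
        then show ?thesis by simp
      qed
      from that(1) consider k where "k \<in> {1..2 * N - 1}" "i = L1 k" | k where "k \<in> {1..2 * N - 1}" "i = R1 k"
        | k where "k \<in> {1..2 * N - 1}" "i = L2 k" | k where "k \<in> {1..2 * N - 1}" "i = R2 k"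
        by (auto simp: clocks2_def)
      then show ?thesis
      proof cases
        case (1 k)
        then have "flip2 N i h = (shift N 1 k h1, h2)" using that(3) unfolding h by (auto split: if_splits)
        then show ?thesis
          unfolding h 1(2) using div1[OF weight_shift_up[OF 1(1)]] 1(2) by (simp add: weight_area2 h)
      next
        case (2 k)
        then have "flip2 N i h = (shift N (- 1) k h1, h2)" using that(3) unfolding h by (auto split: if_splits)
        then show ?thesis
          unfolding h 2(2) using div1[OF weight_shift_down[OF 2(1)]] 2(2) by (simp add: weight_area2 h)
      next
        case (3 k)
        then have "flip2 N i h = (h1, shift N 1 k h2)" using that(3) unfolding h by (auto split: if_splits)
        then show ?thesis
          unfolding h 3(2) using div2[OF weight_shift_up[OF 3(1)] Wpos Wpos] 3(2) by (simp add: weight_area2 h)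
      next
        case (4 k)
        then have "flip2 N i h = (h1, shift N (- 1) k h2)" using that(3) unfolding h by (auto split: if_splits)
        then show ?thesis
          unfolding h 4(2) using div2[OF weight_shift_down[OF 4(1)] Wpos Wpos] 4(2) by (simp add: weight_area2 h)
      qed
    qed
    have "reflect (tent N) (grid N k) \<le> tent N (grid N k)" if "k \<le> 2 * N" for k
      using tent_nonneg[OF N grid_in[OF N that]] grid_in[OF N that] by (simp add: reflect_def)
    then show "(tent N, reflect (tent N)) \<in> C2 N"
      using tent_in_C1[OF N] reflect_in_C1[OF N] by (auto simp: C2_iff)
    show "\<exists>i\<in>clocks2 N. ?V h < ?V (flip2 N i h)" if "h \<in> C2 N" "h \<noteq> (tent N, reflect (tent N))" for h
    proof -
      obtain h1 h2 where h: "h = (h1, h2)" by fastforce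
      have h': "h1 \<in> C1 N" "h2 \<in> C1 N" using that(1) inC1 unfolding h by auto
      show ?thesis
      proof (cases "h1 = tent N")
        case False
        then obtain k where k: "k \<in> {1..2 * N - 1}" "0 < laplacian N h1 k"
          using exists_local_min[OF N h'(1)] by blast
        then have "?V h < ?V (flip2 N (L1 k) h)"
          unfolding h using eps_pos[OF N] by (simp add: height_shift[OF N])
        moreover have "L1 k \<in> clocks2 N" using k(1) by (auto simp: clocks2_def)
        ultimately show ?thesis by blast
      next
        case True
        then have "h2 \<noteq> reflect (tent N)" using that(2) h by simp
        then obtain k where k: "k \<in> {1..2 * N - 1}" "laplacian N h2 k < 0"
          using exists_local_max[OF N h'(2)] by blast
        then have "?V h < ?V (flip2 N (R2 k) h)"
          unfolding h using eps_pos[OF N] by (simp add: height_shift[OF N])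
        moreover have "R2 k \<in> clocks2 N" using k(1) by (auto simp: clocks2_def)
        ultimately show ?thesis by blast
      qed
    qed
  qed
  interpret driven_flips "C2 N" "clocks2 N" "flip2 N" undo2 "rate2 N p q" "weight N (area2 N p q)"
    "(tent N, reflect (tent N))" ?V M X H "solves2 N"
  proof
    show "independent_poisson M (clocks2 N) (rate2 N p q) X" "driven_chain M (C2 N) (solves2 N) X H"
      by (rule driving, rule chain)
    fix n :: "clock2 \<Rightarrow> real \<Rightarrow> nat" and x s t z
    assume n: "solves2 N n x" "\<And>i. i \<in> clocks2 N \<Longrightarrow> counting_path (n i)"
      and x: "\<And>t. 0 \<le> t \<Longrightarrow> x t \<in> C2 N" and st: "0 \<le> s" "s \<le> t" and z: "z \<in> symbols"
      and jump: "\<And>i. i \<in> clocks2 N \<Longrightarrow> n i t = n i s + of_bool (z = Some i)"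
    \<comment> \<open>The Boolean tells the upper surface from the lower one.\<close>
    define obs where "obs = (\<lambda>(upper, k) h. (if upper then fst h else snd h) (grid N k) :: real)"
    define up where "up = (\<lambda>(upper, k). if upper then L1 k else L2 k)"
    define dn where "dn = (\<lambda>(upper, k). if upper then R1 k else R2 k)"
    define A where "A = (\<lambda>(upper, k) h. if upper then 0 < laplacian N (fst h) k
      else 0 < laplacian N (snd h) k \<and> snd h (grid N k) < fst h (grid N k))"
    define B where "B = (\<lambda>(upper, k) h. if upper then laplacian N (fst h) k < 0 \<and> snd h (grid N k) < fst h (grid N k)
      else laplacian N (snd h) k < 0)"
    define xm where "xm = (\<lambda>s. (before (\<lambda>t. fst (x t)) s, before (\<lambda>t. snd (x t)) s))"
    let ?K = "UNIV \<times> {1..2 * N - 1} :: (bool \<times> nat) set"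
    note defs = obs_def up_def dn_def A_def B_def xm_def
    have upd: "obs uk (x t) = obs uk (x s) + 2 / sqrt (2 * real N) *
      (of_bool (z = Some (up uk) \<and> A uk (x s)) - of_bool (z = Some (dn uk) \<and> B uk (x s)))"
      if uk: "uk \<in> ?K" for uk
    proof (rule one_jump_update[where obs = obs and K = ?K and C = "C2 N" and up = up and dn = dn
          and A = A and B = B and xm = xm and n = n and I = "clocks2 N"
          and x = x and s = s and t = t and z = z and k = uk and c = "2 / sqrt (2 * real N)"])
      show "obs uk (x t) = obs uk (x 0) + 2 / sqrt (2 * real N) *
        (count_integral (n (up uk)) (\<lambda>s. A uk (xm s)) t - count_integral (n (dn uk)) (\<lambda>s. B uk (xm s)) t)"
        if "0 \<le> t" "uk \<in> ?K" for t uk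
      proof (cases uk)
        case (Pair upper k)
        then have k: "k \<in> {1..2 * N - 1}" using that(2) by simp
        note eqs = n(1)[unfolded solves2_def Let_def, rule_format, OF that(1) k]
        show ?thesis
          unfolding Pair by (cases upper) (simp_all only: defs prod.case if_True if_False fst_conv snd_conv eqs[THEN conjunct1] eqs[THEN conjunct2])
      qed
      show "h = h'" if h: "h \<in> C2 N" "h' \<in> C2 N" and eq: "\<And>uk. uk \<in> ?K \<Longrightarrow> obs uk h = obs uk h'" for h h'
      proof (rule prod_eqI)
        show "fst h = fst h'"
          using h eq[of "(True, _)"] by (intro C1_eqI[OF N]) (auto simp: C2_def obs_def)
        show "snd h = snd h'"
          using h eq[of "(False, _)"] by (intro C1_eqI[OF N]) (auto simp: C2_def obs_def)
      qed
      show "xm \<sigma> = h" if "s < \<sigma>" "\<And>r. s \<le> r \<Longrightarrow> r < \<sigma> \<Longrightarrow> x r = h" for s \<sigma> h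
        unfolding xm_def by (intro prod_eqI) (auto intro!: before_eq[OF that(1)] simp: that(2))
      show "up uk \<in> clocks2 N \<and> dn uk \<in> clocks2 N" if "uk \<in> ?K" for uk
        using that by (auto simp: clocks2_def up_def dn_def)
    qed (fact x n st jump uk)+
    have act: "act z (x s) \<in> C2 N" using act_closed[OF z x] st by simp
    have xt: "x t \<in> C2 N" using x st by simp
    obtain h1 h2 where h: "x s = (h1, h2)" by fastforce
    have fst_eq: "fst (x t) (grid N k) = fst (act z (x s)) (grid N k)" if k: "k \<in> {1..2 * N - 1}" for k
    proof -
      have k': "k \<le> 2 * N" using k by auto
      consider "z = None" | j where "z = Some (L1 j)" | j where "z = Some (R1 j)"
        | j where "z = Some (L2 j)" | j where "z = Some (R2 j)"
        using clock2.exhaust option.exhaust by metis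
      then show ?thesis
        using upd[of "(True, k)"] k
        by cases (auto simp: defs act_def shift_grid[OF N k'] eps_def h)
    qed
    have snd_eq: "snd (x t) (grid N k) = snd (act z (x s)) (grid N k)" if k: "k \<in> {1..2 * N - 1}" for k
    proof -
      have k': "k \<le> 2 * N" using k by auto
      consider "z = None" | j where "z = Some (L1 j)" | j where "z = Some (R1 j)"
        | j where "z = Some (L2 j)" | j where "z = Some (R2 j)"
        using clock2.exhaust option.exhaust by metis
      then show ?thesis
        using upd[of "(False, k)"] k
        by cases (auto simp: defs act_def shift_grid[OF N k'] eps_def h)
    qed
    show "x t = act z (x s)"
    proof (rule prod_eqI)
      show "fst (x t) = fst (act z (x s))"
        using act xt fst_eq by (intro C1_eqI[OF N]) (auto simp: C2_def)
      show "snd (x t) = snd (act z (x s))"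
        using act xt snd_eq by (intro C1_eqI[OF N]) (auto simp: C2_def)
    qed
  qed
  show ?thesis
    using unique_reversible_law unfolding gibbs_law_def .
qed

end

text \<open>For a path above the wall, the guard leaves room for one flip: by the lattice structure a height above
  one step is at least two steps.\<close>

lemma C1w_shift:
  assumes N: "1 \<le> N" and h: "h \<in> C1w N" and k: "k \<in> {1..2 * N - 1}"
  shows "0 < laplacian N h k \<Longrightarrow> shift N 1 k h \<in> C1w N \<and> eps N < shift N 1 k h (grid N k)"
    and "laplacian N h k < 0 \<Longrightarrow> eps N < h (grid N k) \<Longrightarrow> shift N (- 1) k h \<in> C1w N"
proof -
  have h': "h \<in> C1 N" and nonneg: "\<And>j. j \<le> 2 * N \<Longrightarrow> 0 \<le> h (grid N j)"
    using h grid_in[OF N] by (auto simp: C1w_def)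
  have k': "k \<le> 2 * N" using k by auto
  have in_C1w: "f \<in> C1w N" if "f \<in> C1 N" "\<And>j. j \<le> 2 * N \<Longrightarrow> 0 \<le> f (grid N j)" for f
    using that C1_nonneg[OF N, of f] by (simp add: C1w_def)
  {
    assume "0 < laplacian N h k"
    then have "shift N 1 k h \<in> C1 N" using shift_in_C1[OF N h' k, of 1] by simp
    then have "shift N 1 k h \<in> C1w N"
      using nonneg eps_pos[OF N] by (intro in_C1w) (auto simp: shift_grid[OF N])
    moreover have "eps N < shift N 1 k h (grid N k)"
      using nonneg[OF k'] eps_pos[OF N] by (simp add: shift_grid[OF N k'])
    ultimately show "shift N 1 k h \<in> C1w N \<and> eps N < shift N 1 k h (grid N k)" by simp
  }
  assume "laplacian N h k < 0" and less: "eps N < h (grid N k)"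
  then have "shift N (- 1) k h \<in> C1 N" using shift_in_C1[OF N h' k, of "- 1"] by simp
  then show "shift N (- 1) k h \<in> C1w N"
    using nonneg C1_gap_one[OF N h' k' less] by (intro in_C1w) (auto simp: shift_grid[OF N])
qed


theorem proposition1:
  fixes N :: nat and p q :: "real \<Rightarrow> real"
    and M :: "'w measure"
    and X :: "clock \<Rightarrow> real \<Rightarrow> 'w \<Rightarrow> nat"
    and X2 :: "clock2 \<Rightarrow> real \<Rightarrow> 'w \<Rightarrow> nat"
    and H Hw :: "(real \<Rightarrow> real) \<Rightarrow> real \<Rightarrow> 'w \<Rightarrow> (real \<Rightarrow> real)"
    and H2 :: "(real \<Rightarrow> real) \<times> (real \<Rightarrow> real) \<Rightarrow> real \<Rightarrow> 'w \<Rightarrow> (real \<Rightarrow> real) \<times> (real \<Rightarrow> real)"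
  assumes "N \<ge> 1"
    and "\<And>k. k \<in> {1..2*N - 1} \<Longrightarrow>
           p (grid N k) > 0 \<and> q (grid N k) > 0 \<and> p (grid N k) + q (grid N k) = (2 * real N)\<^sup>2"
  shows
   "(independent_poisson M (clocks N) (rate N p q) X \<and>
     driven_chain M (C1 N) (solves1 N) X H \<longrightarrow>
       (\<exists>\<mu>. gibbs_law N (C1 N) (area1 N p q) \<mu> \<and>
          reversible_law (C1 N) (transition M H) \<mu> \<and>
          invariant_law (C1 N) (transition M H) \<mu> \<and>
          (\<forall>\<nu>. invariant_law (C1 N) (transition M H) \<nu> \<longrightarrow> \<nu> = \<mu>)))
  \<and> (independent_poisson M (clocks N) (rate N p q) X \<and>
     driven_chain M (C1w N) (solves1w N) X Hw \<longrightarrow>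
       (\<exists>\<mu>. gibbs_law N (C1w N) (area1 N p q) \<mu> \<and>
          reversible_law (C1w N) (transition M Hw) \<mu> \<and>
          invariant_law (C1w N) (transition M Hw) \<mu> \<and>
          (\<forall>\<nu>. invariant_law (C1w N) (transition M Hw) \<nu> \<longrightarrow> \<nu> = \<mu>)))
  \<and> (independent_poisson M (clocks2 N) (rate2 N p q) X2 \<and>
     driven_chain M (C2 N) (solves2 N) X2 H2 \<longrightarrow>
       (\<exists>\<mu>. gibbs_law N (C2 N) (area2 N p q) \<mu> \<and>
          reversible_law (C2 N) (transition M H2) \<mu> \<and>
          invariant_law (C2 N) (transition M H2) \<mu> \<and>
          (\<forall>\<nu>. invariant_law (C2 N) (transition M H2) \<nu> \<longrightarrow> \<nu> = \<mu>)))"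
proof (intro conjI impI; elim conjE)
  note N = assms(1)
  have rates: "\<And>k. k \<in> {1..2 * N - 1} \<Longrightarrow> 0 < p (grid N k) \<and> 0 < q (grid N k)"
    using assms(2) by blast
  {
    assume driving: "independent_poisson M (clocks N) (rate N p q) X"
      and chain: "driven_chain M (C1 N) (solves1 N) X H"
    show "\<exists>\<mu>. gibbs_law N (C1 N) (area1 N p q) \<mu> \<and>
          reversible_law (C1 N) (transition M H) \<mu> \<and>
          invariant_law (C1 N) (transition M H) \<mu> \<and>
          (\<forall>\<nu>. invariant_law (C1 N) (transition M H) \<nu> \<longrightarrow> \<nu> = \<mu>)"
    proof (rule one_surface_model[OF N rates _ _ _ _ _ driving chain, where g = "\<lambda>_ _. True"])
      show "tent N \<in> C1 N" by (rule tent_in_C1[OF N])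
      show "shift N 1 k h \<in> C1 N \<and> True"
        if "h \<in> C1 N" "k \<in> {1..2 * N - 1}" "0 < laplacian N h k" for h k
        using shift_in_C1[OF N that(1,2), of 1] that(3) by simp
      show "shift N (- 1) k h \<in> C1 N"
        if "h \<in> C1 N" "k \<in> {1..2 * N - 1}" "laplacian N h k < 0" for h k
        using shift_in_C1[OF N that(1,2), of "- 1"] that(3) by simp
      show "\<forall>t\<ge>0. \<forall>k\<in>{1..2 * N - 1}.
        x t (grid N k) = x 0 (grid N k) + 2 / sqrt (2 * real N) *
          (count_integral (n (L k)) (\<lambda>s. 0 < laplacian N (before x s) k) t
         - count_integral (n (R k)) (\<lambda>s. laplacian N (before x s) k < 0 \<and> True) t)"
        if "solves1 N n x" for n x
        using that unfolding solves1_def simp_thms .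
    qed simp_all
  next
    assume driving: "independent_poisson M (clocks N) (rate N p q) X"
      and chain: "driven_chain M (C1w N) (solves1w N) X Hw"
    show "\<exists>\<mu>. gibbs_law N (C1w N) (area1 N p q) \<mu> \<and>
          reversible_law (C1w N) (transition M Hw) \<mu> \<and>
          invariant_law (C1w N) (transition M Hw) \<mu> \<and>
          (\<forall>\<nu>. invariant_law (C1w N) (transition M Hw) \<nu> \<longrightarrow> \<nu> = \<mu>)"
    proof (rule one_surface_model[OF N rates _ _ _ _ _ driving chain,
          where g = "\<lambda>k h. eps N < h (grid N k)"])
      show "C1w N \<subseteq> C1 N" by (auto simp: C1w_def)
      show "tent N \<in> C1w N"
        using tent_in_C1[OF N] tent_nonneg[OF N] by (simp add: C1w_def)
      show "\<forall>t\<ge>0. \<forall>k\<in>{1..2 * N - 1}.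
        x t (grid N k) = x 0 (grid N k) + 2 / sqrt (2 * real N) *
          (count_integral (n (L k)) (\<lambda>s. 0 < laplacian N (before x s) k) t
         - count_integral (n (R k)) (\<lambda>s. laplacian N (before x s) k < 0 \<and> eps N < before x s (grid N k)) t)"
        if "solves1w N n x" for n x
        using that unfolding solves1w_def eps_def .
    qed (use C1w_shift[OF N] in auto)
  next
    assume driving: "independent_poisson M (clocks2 N) (rate2 N p q) X2"
      and chain: "driven_chain M (C2 N) (solves2 N) X2 H2"
    show "\<exists>\<mu>. gibbs_law N (C2 N) (area2 N p q) \<mu> \<and>
          reversible_law (C2 N) (transition M H2) \<mu> \<and>
          invariant_law (C2 N) (transition M H2) \<mu> \<and>
          (\<forall>\<nu>. invariant_law (C2 N) (transition M H2) \<nu> \<longrightarrow> \<nu> = \<mu>)"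
      by (rule two_surface_model[OF N _ driving chain]) (rule rates)
  }
qed

end
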